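(* Let $\gamma$ be a smooth real-valued function of $t$ and $V=i\gamma(t)x$. The maximal Lie invariance algebra $\mathfrak g_V$ of the equation $i\psi_t+\psi_{xx}+i\gamma(t)x\psi=0$ is spanned by the vector fields $D_{\gamma}(\tau)$, $G(1)+\rho^1I$, $G(t)+\rho^2I$, $M$, $I$, $Z(\eta^0)$, where $D_\gamma(\tau):=\tau\partial_t+\frac12\tau_tx\partial_x+\frac18\tau_{tt}x^2M-\frac14\tau_tI$, the parameter $\tau$ runs through the set of polynomials in $t$ of degree at most two satisfying $(\gamma|\tau|^{3/2})_t=0$, $\rho^1=-\int\gamma(t)\,dt$, $\rho^2=-\int t\gamma(t)\,dt$, and $\eta^0$ runs through the solution set of the equation.
   Context: $\psi$ is a complex-valued function of real $t,x$; $\psi^*$ is treated as an additional dependent variable and vector fields act on the space of $(t,x,\psi,\psi^* )$. Notation: $M=i\psi\partial_\psi-i\psi^*\partial_{\psi^*}$, $I=\psi\partial_\psi+\psi^*\partial_{\psi^*}$, $G(\chi)=\chi\partial_x+\frac12\chi_txM$, $Z(\eta)=\eta\partial_\psi+\eta^*\partial_{\psi^*}$. *)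

theory Defs
  imports "HOL-Analysis.Analysis" "HOL-Computational_Algebra.Polynomial"
begin

coinductive smooth :: "('a::euclidean_space \<Rightarrow> 'b::real_normed_vector) \<Rightarrow> bool" where
  "continuous_on UNIV f \<Longrightarrow>
   (\<forall>i\<in>Basis. \<exists>g. (\<forall>p. ((\<lambda>s. f (p + s *\<^sub>R i)) has_vector_derivative g p) (at 0)) \<and> smooth g)
   \<Longrightarrow> smooth f"

definition dt :: "(real \<Rightarrow> real \<Rightarrow> complex) \<Rightarrow> real \<Rightarrow> real \<Rightarrow> complex" where
  "dt g t x = vector_derivative (\<lambda>s. g s x) (at t)"

definition dx :: "(real \<Rightarrow> real \<Rightarrow> complex) \<Rightarrow> real \<Rightarrow> real \<Rightarrow> complex" where
  "dx g t x = vector_derivative (\<lambda>s. g t s) (at x)"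

definition eqop :: "(real \<Rightarrow> real) \<Rightarrow> (real \<Rightarrow> real \<Rightarrow> complex) \<Rightarrow> real \<Rightarrow> real \<Rightarrow> complex" where
  "eqop \<gamma> f t x = \<i> * dt f t x + dx (dx f) t x + \<i> * complex_of_real (\<gamma> t * x) * f t x"

definition is_solution :: "(real \<Rightarrow> real) \<Rightarrow> (real \<Rightarrow> real \<Rightarrow> complex) \<Rightarrow> bool" where
  "is_solution \<gamma> f \<longleftrightarrow> smooth (\<lambda>(t,x). f t x) \<and> (\<forall>t x. eqop \<gamma> f t x = 0)"

text \<open>A (real) vector field  tau d_t + xi d_x + eta d_psi + eta* d_psi*  is represented by
  the triple (tau, xi, eta); tau, xi are real-valued, eta complex-valued, all functions of
  (t, x, psi) (dependence on psi* = conj psi is included since eta need not be holomorphic).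
  The psi*-component is the complex conjugate of eta.\<close>

type_synonym vf = "(real \<Rightarrow> real \<Rightarrow> complex \<Rightarrow> real) \<times> (real \<Rightarrow> real \<Rightarrow> complex \<Rightarrow> real)
                    \<times> (real \<Rightarrow> real \<Rightarrow> complex \<Rightarrow> complex)"

definition vf_smooth :: "vf \<Rightarrow> bool" where
  "vf_smooth Q = (case Q of (\<tau>, \<xi>, \<eta>) \<Rightarrow>
     smooth (\<lambda>(t,x,z). \<tau> t x z) \<and> smooth (\<lambda>(t,x,z). \<xi> t x z) \<and> smooth (\<lambda>(t,x,z). \<eta> t x z))"

definition vf_zero :: vf where
  "vf_zero = (\<lambda>t x z. 0, \<lambda>t x z. 0, \<lambda>t x z. 0)"

definition vf_add :: "vf \<Rightarrow> vf \<Rightarrow> vf" where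
  "vf_add P Q = (case P of (\<tau>1, \<xi>1, \<eta>1) \<Rightarrow> case Q of (\<tau>2, \<xi>2, \<eta>2) \<Rightarrow>
     (\<lambda>t x z. \<tau>1 t x z + \<tau>2 t x z, \<lambda>t x z. \<xi>1 t x z + \<xi>2 t x z, \<lambda>t x z. \<eta>1 t x z + \<eta>2 t x z))"

definition vf_scale :: "real \<Rightarrow> vf \<Rightarrow> vf" where
  "vf_scale c Q = (case Q of (\<tau>, \<xi>, \<eta>) \<Rightarrow>
     (\<lambda>t x z. c * \<tau> t x z, \<lambda>t x z. c * \<xi> t x z, \<lambda>t x z. complex_of_real c * \<eta> t x z))"

inductive_set vf_span :: "vf set \<Rightarrow> vf set" for S where
  zero: "vf_zero \<in> vf_span S"
| step: "P \<in> vf_span S \<Longrightarrow> Q \<in> S \<Longrightarrow> vf_add P (vf_scale c Q) \<in> vf_span S"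

text \<open>Characteristic  Phi = eta - tau psi_t - xi psi_x  evaluated along a function f, and the
  prolongation coefficients  eta^J = D_J Phi + tau psi_{Jt} + xi psi_{Jx}  evaluated on the jet of f.\<close>

definition charac :: "vf \<Rightarrow> (real \<Rightarrow> real \<Rightarrow> complex) \<Rightarrow> real \<Rightarrow> real \<Rightarrow> complex" where
  "charac Q f t x = (case Q of (\<tau>, \<xi>, \<eta>) \<Rightarrow>
     \<eta> t x (f t x) - complex_of_real (\<tau> t x (f t x)) * dt f t x
                   - complex_of_real (\<xi> t x (f t x)) * dx f t x)"

definition eta_t :: "vf \<Rightarrow> (real \<Rightarrow> real \<Rightarrow> complex) \<Rightarrow> real \<Rightarrow> real \<Rightarrow> complex" where
  "eta_t Q f t x = (case Q of (\<tau>, \<xi>, \<eta>) \<Rightarrow>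
     dt (charac Q f) t x + complex_of_real (\<tau> t x (f t x)) * dt (dt f) t x
                         + complex_of_real (\<xi> t x (f t x)) * dx (dt f) t x)"

definition eta_xx :: "vf \<Rightarrow> (real \<Rightarrow> real \<Rightarrow> complex) \<Rightarrow> real \<Rightarrow> real \<Rightarrow> complex" where
  "eta_xx Q f t x = (case Q of (\<tau>, \<xi>, \<eta>) \<Rightarrow>
     dx (dx (charac Q f)) t x + complex_of_real (\<tau> t x (f t x)) * dt (dx (dx f)) t x
                              + complex_of_real (\<xi> t x (f t x)) * dx (dx (dx f)) t x)"

text \<open>Q is a Lie symmetry: smooth, and pr^(2) Q applied to
  Delta = i psi_t + psi_xx + i gamma(t) x psi  vanishes at every point of the solution manifold
  (every 2-jet is realised by a smooth function f, so quantifying over f and points where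
  the equation holds for the jet of f is quantifying over the solution manifold in jet space).
  The conjugate equation gives the conjugate condition, as Q is real.\<close>

definition is_lie_symmetry :: "(real \<Rightarrow> real) \<Rightarrow> vf \<Rightarrow> bool" where
  "is_lie_symmetry \<gamma> Q \<longleftrightarrow> vf_smooth Q \<and>
     (\<forall>f. smooth (\<lambda>(t,x). f t x) \<longrightarrow> (\<forall>t x. eqop \<gamma> f t x = 0 \<longrightarrow>
        (case Q of (\<tau>, \<xi>, \<eta>) \<Rightarrow>
          \<i> * eta_t Q f t x + eta_xx Q f t x
          + \<i> * complex_of_real (\<gamma> t * x) * \<eta> t x (f t x)
          + \<i> * complex_of_real (\<tau> t x (f t x) * deriv \<gamma> t * x + \<xi> t x (f t x) * \<gamma> t) * f t x) = 0))"

definition vfM :: vf where "vfM = (\<lambda>t x z. 0, \<lambda>t x z. 0, \<lambda>t x z. \<i> * z)"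
definition vfI :: vf where "vfI = (\<lambda>t x z. 0, \<lambda>t x z. 0, \<lambda>t x z. z)"

definition vfrhoI :: "(real \<Rightarrow> real) \<Rightarrow> vf" where
  "vfrhoI \<rho> = (\<lambda>t x z. 0, \<lambda>t x z. 0, \<lambda>t x z. complex_of_real (\<rho> t) * z)"

definition vfG :: "(real \<Rightarrow> real) \<Rightarrow> vf" where
  "vfG ch = (\<lambda>t x z. 0, \<lambda>t x z. ch t,
             \<lambda>t x z. \<i> * complex_of_real (deriv ch t * x / 2) * z)"

definition vfZ :: "(real \<Rightarrow> real \<Rightarrow> complex) \<Rightarrow> vf" where
  "vfZ \<eta>0 = (\<lambda>t x z. 0, \<lambda>t x z. 0, \<lambda>t x z. \<eta>0 t x)"

definition vfD :: "real poly \<Rightarrow> vf" where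
  "vfD p = (\<lambda>t x z. poly p t, \<lambda>t x z. poly (pderiv p) t * x / 2,
            \<lambda>t x z. (\<i> * complex_of_real (poly (pderiv (pderiv p)) t * x\<^sup>2 / 8)
                       - complex_of_real (poly (pderiv p) t / 4)) * z)"

definition admissible_tau :: "(real \<Rightarrow> real) \<Rightarrow> real poly \<Rightarrow> bool" where
  "admissible_tau \<gamma> p \<longleftrightarrow> degree p \<le> 2 \<and>
     (\<forall>t. ((\<lambda>s. \<gamma> s * \<bar>poly p s\<bar> powr (3/2)) has_real_derivative 0) (at t))"

definition generators :: "(real \<Rightarrow> real) \<Rightarrow> (real \<Rightarrow> real) \<Rightarrow> (real \<Rightarrow> real) \<Rightarrow> vf set" where
  "generators \<gamma> \<rho>1 \<rho>2 =
     {vfD p | p. admissible_tau \<gamma> p}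
     \<union> {vf_add (vfG (\<lambda>t. 1)) (vfrhoI \<rho>1), vf_add (vfG (\<lambda>t. t)) (vfrhoI \<rho>2), vfM, vfI}
     \<union> {vfZ \<eta>0 | \<eta>0. is_solution \<gamma> \<eta>0}"

end

theory Submission
  imports Defs
begin

text \<open>
  Along a test function \<open>f\<close> the prolonged field applied to the equation is a polynomial in the jet of
  \<open>f\<close> whose third-order terms cancel, and the only constraint on the jet
  \<open>(\<psi>, \<psi>\<^sub>x, \<psi>\<^sub>x\<^sub>x, \<psi>\<^sub>t, \<psi>\<^sub>t\<^sub>x)\<close> is \<open>\<psi>\<^sub>t = \<i> \<psi>\<^sub>x\<^sub>x - \<gamma> x \<psi>\<close>. Its coefficients at \<open>\<psi>\<^sub>t\<^sub>x\<close>, then \<open>\<psi>\<^sub>x\<^sub>x\<close>, then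
  \<open>\<psi>\<^sub>x\<close> force \<open>\<tau> = \<tau>(t)\<close>, \<open>\<xi> = \<tau>\<^sub>t x / 2 + \<sigma>(t)\<close> and \<open>\<eta> = \<eta>0 + \<eta>1 \<psi>\<close>. What remains says that
  \<open>\<eta>0\<close> is a solution, \<open>2 \<eta>1\<^sub>x = \<i> (\<sigma>\<^sub>t + \<tau>\<^sub>t\<^sub>t x / 2)\<close>, and an equation that is polynomial in \<open>x\<close>; its
  coefficients give \<open>\<tau>\<^sub>t\<^sub>t\<^sub>t = 0\<close>, \<open>\<sigma>\<^sub>t\<^sub>t = 0\<close>, \<open>\<tau> \<gamma>\<^sub>t + (3/2) \<tau>\<^sub>t \<gamma> = 0\<close> and determine \<open>\<eta>1\<close> up to a
  complex constant.
\<close>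

section \<open>Smooth functions\<close>

text \<open>Moving the coordinates one at a time splits the increment of \<open>f\<close> into
  one-dimensional increments, each close to its linear part by the mean value inequality and the
  continuity of that partial at \<open>p\<close>. The partials are given at parameter 0 for every
  base point, the form in which \<open>smooth\<close> provides them; \<open>line\<close> transports
  them to any other parameter.\<close>

lemma has_derivative_from_partials:
  fixes f :: "'a::euclidean_space \<Rightarrow> 'b::real_normed_vector"
  assumes g: "\<And>i p. i \<in> Basis \<Longrightarrow> ((\<lambda>s. f (p + s *\<^sub>R i)) has_vector_derivative g i p) (at 0)"
    and cont: "\<And>i. i \<in> Basis \<Longrightarrow> isCont (g i) p"
  shows "(f has_derivative (\<lambda>h. \<Sum>i\<in>Basis. (h \<bullet> i) *\<^sub>R g i p)) (at p)"
proof -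
  have line: "((\<lambda>s. f (q + s *\<^sub>R i)) has_vector_derivative g i (q + s *\<^sub>R i)) (at s)"
    if "i \<in> Basis" for i q s
  proof -
    have "((\<lambda>r. f ((q + s *\<^sub>R i) + r *\<^sub>R i)) has_vector_derivative g i (q + s *\<^sub>R i)) (at (s - s))"
      using g[OF that, of "q + s *\<^sub>R i"] by simp
    moreover have "((\<lambda>r. r - s) has_vector_derivative 1) (at s)"
      by (auto intro!: derivative_eq_intros)
    ultimately have "((\<lambda>r. f ((q + s *\<^sub>R i) + (r - s) *\<^sub>R i)) has_vector_derivative g i (q + s *\<^sub>R i)) (at s)"
      using vector_diff_chain_at[of "\<lambda>r. r - s" 1 s "\<lambda>r. f ((q + s *\<^sub>R i) + r *\<^sub>R i)" "g i (q + s *\<^sub>R i)"]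
      by (auto simp: o_def)
    then show ?thesis by (simp add: algebra_simps)
  qed
  \<comment> \<open>Induction over the set of coordinates that move. The base point \<open>q\<close>
    has to vary near \<open>p\<close>, because the new coordinate \<open>j\<close> is moved first
    and the induction hypothesis is then applied at the shifted point \<open>q'\<close>.\<close>
  have key: "\<forall>\<epsilon>>0. \<exists>\<delta>>0. \<forall>q h. dist q p < \<delta> \<longrightarrow> norm h < \<delta> \<longrightarrow>
      norm (f (q + (\<Sum>i\<in>B. (h \<bullet> i) *\<^sub>R i)) - f q - (\<Sum>i\<in>B. (h \<bullet> i) *\<^sub>R g i p)) \<le> \<epsilon> * norm h"
    if "B \<subseteq> Basis" for B
    using finite_subset[OF that finite_Basis] that
  proof (induction B rule: finite_induct)
    case empty
    show ?case by (auto intro!: exI[of _ 1])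
  next
    case (insert j B)
    show ?case
    proof (intro allI impI)
      fix \<epsilon> :: real assume "\<epsilon> > 0"
      then have e2: "\<epsilon>/2 > 0" by simp
      obtain \<delta>1 where d1: "\<delta>1 > 0" "\<And>q h. dist q p < \<delta>1 \<Longrightarrow> norm h < \<delta>1 \<Longrightarrow>
        norm (f (q + (\<Sum>i\<in>B. (h \<bullet> i) *\<^sub>R i)) - f q - (\<Sum>i\<in>B. (h \<bullet> i) *\<^sub>R g i p)) \<le> \<epsilon>/2 * norm h"
        using insert.IH insert.prems e2 by (meson insert_subset)
      have j: "j \<in> Basis" using insert.prems by auto
      obtain \<delta>2 where d2: "\<delta>2 > 0" "\<And>q. dist q p < \<delta>2 \<Longrightarrow> dist (g j q) (g j p) < \<epsilon>/2"
        using cont[OF j] e2 unfolding continuous_at_eps_delta by metis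
      \<comment> \<open>Halved because the distance from \<open>p\<close> collects one \<delta> from
        \<open>q\<close> and one from \<open>h\<close>.\<close>
      define \<delta> where "\<delta> = min \<delta>1 \<delta>2 / 2"
      have \<delta>: "\<delta> > 0" "2 * \<delta> \<le> \<delta>1" "2 * \<delta> \<le> \<delta>2" using d1 d2 by (auto simp: \<delta>_def)
      have "norm (f (q + (\<Sum>i\<in>insert j B. (h \<bullet> i) *\<^sub>R i)) - f q - (\<Sum>i\<in>insert j B. (h \<bullet> i) *\<^sub>R g i p)) \<le> \<epsilon> * norm h"
        if q: "dist q p < \<delta>" and h: "norm h < \<delta>" for q h
      proof -
        define q' where "q' = q + (h \<bullet> j) *\<^sub>R j"
        have hj: "\<bar>h \<bullet> j\<bar> \<le> norm h" using j by (simp add: Basis_le_norm)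
        have near: "dist (q + s *\<^sub>R j) p < 2 * \<delta>" if "\<bar>s\<bar> \<le> \<bar>h \<bullet> j\<bar>" for s
        proof -
          have "dist (q + s *\<^sub>R j) p \<le> dist q p + norm (s *\<^sub>R j)"
            by (metis add.commute dist_commute dist_norm dist_triangle2 dist_triangle_le add_diff_cancel_left' order_refl)
          then show ?thesis using q h hj that j by simp
        qed
        have 1: "norm (f (q' + (\<Sum>i\<in>B. (h \<bullet> i) *\<^sub>R i)) - f q' - (\<Sum>i\<in>B. (h \<bullet> i) *\<^sub>R g i p)) \<le> \<epsilon>/2 * norm h"
          using d1(2)[of q' h] near[of "h \<bullet> j"] \<delta> h unfolding q'_def by simp
        \<comment> \<open>Subtracting the linear part leaves a derivative
          \<open>g j (q + s *\<^sub>R j) - g j p\<close>, which is small by continuity.\<close>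
        define \<phi> where "\<phi> s = f (q + s *\<^sub>R j) - s *\<^sub>R g j p" for s
        have "norm (\<phi> (h \<bullet> j) - \<phi> 0) \<le> \<epsilon>/2 * norm (h \<bullet> j - 0)"
        proof (rule differentiable_bound[where S = "closed_segment 0 (h \<bullet> j)"
              and f' = "\<lambda>s r. r *\<^sub>R (g j (q + s *\<^sub>R j) - g j p)"])
          show "(\<phi> has_derivative (\<lambda>r. r *\<^sub>R (g j (q + s *\<^sub>R j) - g j p))) (at s within closed_segment 0 (h \<bullet> j))" for s
            unfolding \<phi>_def has_vector_derivative_def[symmetric]
            by (rule has_vector_derivative_at_within) (auto intro!: derivative_eq_intros line j)
          show "onorm (\<lambda>r. r *\<^sub>R (g j (q + s *\<^sub>R j) - g j p)) \<le> \<epsilon>/2" if "s \<in> closed_segment 0 (h \<bullet> j)" for s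
          proof (rule onorm_bound)
            have "\<bar>s\<bar> \<le> \<bar>h \<bullet> j\<bar>" using that by (auto simp: closed_segment_eq_real_ivl split: if_splits)
            then have "norm (g j (q + s *\<^sub>R j) - g j p) \<le> \<epsilon>/2"
              using d2(2)[of "q + s *\<^sub>R j"] near[of s] \<delta> by (simp add: dist_norm)
            then show "norm (r *\<^sub>R (g j (q + s *\<^sub>R j) - g j p)) \<le> \<epsilon>/2 * norm r" for r
              by (metis abs_ge_zero mult.commute mult_left_mono norm_scaleR real_norm_def)
          qed (use e2 in simp)
        qed auto
        also have "\<dots> \<le> \<epsilon>/2 * norm h" using hj e2 by (intro mult_left_mono) auto
        finally have 2: "norm (f q' - f q - (h \<bullet> j) *\<^sub>R g j p) \<le> \<epsilon>/2 * norm h"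
          by (simp add: \<phi>_def q'_def algebra_simps)
        have "f (q + (\<Sum>i\<in>insert j B. (h \<bullet> i) *\<^sub>R i)) - f q - (\<Sum>i\<in>insert j B. (h \<bullet> i) *\<^sub>R g i p)
          = (f (q' + (\<Sum>i\<in>B. (h \<bullet> i) *\<^sub>R i)) - f q' - (\<Sum>i\<in>B. (h \<bullet> i) *\<^sub>R g i p))
            + (f q' - f q - (h \<bullet> j) *\<^sub>R g j p)"
          using insert.hyps by (simp add: q'_def algebra_simps)
        then have "norm (f (q + (\<Sum>i\<in>insert j B. (h \<bullet> i) *\<^sub>R i)) - f q - (\<Sum>i\<in>insert j B. (h \<bullet> i) *\<^sub>R g i p))
          \<le> \<epsilon>/2 * norm h + \<epsilon>/2 * norm h"
          by (simp only: norm_triangle_le[OF add_mono[OF 1 2]])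
        then show ?thesis by simp
      qed
      then show "\<exists>\<delta>>0. \<forall>q h. dist q p < \<delta> \<longrightarrow> norm h < \<delta> \<longrightarrow>
        norm (f (q + (\<Sum>i\<in>insert j B. (h \<bullet> i) *\<^sub>R i)) - f q - (\<Sum>i\<in>insert j B. (h \<bullet> i) *\<^sub>R g i p)) \<le> \<epsilon> * norm h"
        using \<delta>(1) by blast
    qed
  qed
  show ?thesis unfolding has_derivative_at_alt
  proof (intro conjI allI impI)
    show "bounded_linear (\<lambda>h. \<Sum>i\<in>Basis. (h \<bullet> i) *\<^sub>R g i p)"
      by (intro bounded_linear_sum bounded_linear_compose[OF bounded_linear_scaleR_left] bounded_linear_inner_left)
    fix \<epsilon> :: real assume "\<epsilon> > 0"
    then obtain \<delta> where d: "\<delta> > 0" "\<And>q h. dist q p < \<delta> \<Longrightarrow> norm h < \<delta> \<Longrightarrow>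
        norm (f (q + (\<Sum>i\<in>Basis. (h \<bullet> i) *\<^sub>R i)) - f q - (\<Sum>i\<in>Basis. (h \<bullet> i) *\<^sub>R g i p)) \<le> \<epsilon> * norm h"
      using key[of Basis] by blast
    show "\<exists>d>0. \<forall>y. norm (y - p) < d \<longrightarrow>
        norm (f y - f p - (\<Sum>i\<in>Basis. ((y - p) \<bullet> i) *\<^sub>R g i p)) \<le> \<epsilon> * norm (y - p)"
      using d(1) d(2)[of p "y - p" for y] by (intro exI[of _ \<delta>]) (auto simp: euclidean_representation)
  qed
qed

text \<open>Finite orders of differentiability make induction available: the derivative of a product
  is a sum of products, so a direct coinduction on \<open>smooth\<close> does not close.\<close>

primrec Ck :: "nat \<Rightarrow> ('a::euclidean_space \<Rightarrow> 'b::real_normed_vector) \<Rightarrow> bool" where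
  "Ck 0 f \<longleftrightarrow> continuous_on UNIV f"
| "Ck (Suc k) f \<longleftrightarrow> continuous_on UNIV f \<and>
     (\<forall>i\<in>Basis. \<exists>g. (\<forall>p. ((\<lambda>s. f (p + s *\<^sub>R i)) has_vector_derivative g p) (at 0)) \<and> Ck k g)"

lemma smooth_imp_Ck: "smooth f \<Longrightarrow> Ck k f"
proof (induction k arbitrary: f)
  case 0 then show ?case by (auto elim: smooth.cases)
next
  case (Suc k)
  from Suc.prems show ?case
  proof cases
    case 1
    then show ?thesis using Suc.IH by auto metis
  qed
qed

text \<open>From right to left, each order \<open>k\<close> supplies its own derivative
  \<open>G k\<close>. Derivatives are unique, so all of them equal \<open>G 0\<close>, which
  therefore lies in every class, and the coinduction closes.\<close>

lemma smooth_iff_Ck: "smooth f \<longleftrightarrow> (\<forall>k. Ck k f)"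
proof
  assume "\<forall>k. Ck k f"
  then show "smooth f"
  proof (coinduction arbitrary: f rule: smooth.coinduct)
    case smooth
    have "\<exists>g. (\<forall>p. ((\<lambda>s. f (p + s *\<^sub>R i)) has_vector_derivative g p) (at 0)) \<and> (\<forall>k. Ck k g)"
      if i: "i \<in> Basis" for i
    proof -
      have "\<exists>g. (\<forall>p. ((\<lambda>s. f (p + s *\<^sub>R i)) has_vector_derivative g p) (at 0)) \<and> Ck k g" for k
        using smooth[rule_format, of "Suc k"] i by simp
      then obtain G where G: "\<And>k p. ((\<lambda>s. f (p + s *\<^sub>R i)) has_vector_derivative G k p) (at 0)" "\<And>k. Ck k (G k)"
        by metis
      have "G k = G 0" for k
        using vector_derivative_unique_at[OF G(1) G(1)] by blast
      then show ?thesis using G by metis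
    qed
    moreover have "continuous_on UNIV f" using smooth[rule_format, of 0] by simp
    ultimately show ?case by blast
  qed
qed (simp add: smooth_imp_Ck)

lemma Ck_imp_continuous: "Ck k f \<Longrightarrow> continuous_on UNIV f"
  by (cases k) auto

lemma Ck_SucD: "Ck (Suc k) f \<Longrightarrow> Ck k f"
proof (induction k arbitrary: f)
  case (Suc k)
  then show ?case unfolding Ck.simps(2)[of "Suc k"] Ck.simps(2)[of k] by meson
qed auto

lemma Ck_SucE:
  assumes "Ck (Suc k) f"
  obtains g where "\<And>i p. i \<in> Basis \<Longrightarrow> ((\<lambda>s. f (p + s *\<^sub>R i)) has_vector_derivative g i p) (at 0)"
    "\<And>i. i \<in> Basis \<Longrightarrow> Ck k (g i)"
proof -
  have "\<forall>i\<in>Basis. \<exists>g. (\<forall>p. ((\<lambda>s. f (p + s *\<^sub>R i)) has_vector_derivative g p) (at 0)) \<and> Ck k g"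
    using assms by simp
  from bchoice[OF this] show ?thesis using that by blast
qed

lemma Ck_const: "Ck k (\<lambda>_. c)"
proof (induction k arbitrary: c)
  case (Suc k)
  have "((\<lambda>s. c) has_vector_derivative 0) (at (0::real))" by simp
  then show ?case using Suc by (auto intro!: exI[of _ "\<lambda>_. 0"])
qed auto

lemma Ck_add:
  assumes "Ck k f" "Ck k g" shows "Ck k (\<lambda>p. f p + g p)"
  using assms
proof (induction k arbitrary: f g)
  case (Suc k)
  obtain f' where f': "\<And>i p. i \<in> Basis \<Longrightarrow> ((\<lambda>s. f (p + s *\<^sub>R i)) has_vector_derivative f' i p) (at 0)"
    "\<And>i. i \<in> Basis \<Longrightarrow> Ck k (f' i)" using Ck_SucE[OF Suc.prems(1)] by blast
  obtain g' where g': "\<And>i p. i \<in> Basis \<Longrightarrow> ((\<lambda>s. g (p + s *\<^sub>R i)) has_vector_derivative g' i p) (at 0)"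
    "\<And>i. i \<in> Basis \<Longrightarrow> Ck k (g' i)" using Ck_SucE[OF Suc.prems(2)] by blast
  have "\<exists>h. (\<forall>p. ((\<lambda>s. f (p + s *\<^sub>R i) + g (p + s *\<^sub>R i)) has_vector_derivative h p) (at 0)) \<and> Ck k h"
    if "i \<in> Basis" for i
    using Suc.IH[OF f'(2) g'(2), OF that that] has_vector_derivative_add[OF f'(1) g'(1), OF that that]
    by (intro exI[of _ "\<lambda>p. f' i p + g' i p"]) auto
  moreover have "continuous_on UNIV (\<lambda>p. f p + g p)"
    using Suc.prems by (auto intro: continuous_intros)
  ultimately show ?case by simp
qed (auto intro: continuous_intros)

lemma Ck_sum: "(\<And>i. i \<in> I \<Longrightarrow> Ck k (f i)) \<Longrightarrow> Ck k (\<lambda>p. \<Sum>i\<in>I. f i p)"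
  by (induction I rule: infinite_finite_induct) (auto intro: Ck_const Ck_add)

lemma Ck_linear_compose:
  assumes L: "bounded_linear L" and "Ck k f" shows "Ck k (\<lambda>p. L (f p))"
  using assms(2)
proof (induction k arbitrary: f)
  case 0
  then show ?case using bounded_linear.continuous_on[OF L] by auto
next
  case (Suc k)
  obtain f' where f': "\<And>i p. i \<in> Basis \<Longrightarrow> ((\<lambda>s. f (p + s *\<^sub>R i)) has_vector_derivative f' i p) (at 0)"
    "\<And>i. i \<in> Basis \<Longrightarrow> Ck k (f' i)" using Ck_SucE[OF Suc.prems] by blast
  have "\<exists>h. (\<forall>p. ((\<lambda>s. L (f (p + s *\<^sub>R i))) has_vector_derivative h p) (at 0)) \<and> Ck k h"
    if "i \<in> Basis" for i
    using Suc.IH[OF f'(2), OF that] bounded_linear.has_vector_derivative[OF L f'(1), OF that]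
    by (intro exI[of _ "\<lambda>p. L (f' i p)"]) auto
  moreover have "continuous_on UNIV (\<lambda>p. L (f p))"
    using Suc.prems bounded_linear.continuous_on[OF L] by auto
  ultimately show ?case by simp
qed

lemma Ck_linear:
  assumes L: "bounded_linear L" shows "Ck k L"
proof (cases k)
  case 0 then show ?thesis using linear_continuous_on[OF L] by simp
next
  case (Suc n)
  have "((\<lambda>s. L (p + s *\<^sub>R i)) has_vector_derivative L i) (at 0)" for p i
    by (rule bounded_linear.has_vector_derivative[OF L]) (auto intro!: derivative_eq_intros)
  then have "\<exists>g. (\<forall>p. ((\<lambda>s. L (p + s *\<^sub>R i)) has_vector_derivative g p) (at 0)) \<and> Ck n g" for i
    using Ck_const[of n "L i"] by (intro exI[of _ "\<lambda>_. L i"]) auto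
  then show ?thesis using linear_continuous_on[OF L] by (auto simp: Suc)
qed

text \<open>Proved for any bounded bilinear map, since multiplication is wanted for products and
  scaling for the chain rule in \<open>Ck_compose\<close>.\<close>

lemma (in bounded_bilinear) Ck_prod:
  assumes "Ck k f" "Ck k g" shows "Ck k (\<lambda>p. prod (f p) (g p))"
  using assms
proof (induction k arbitrary: f g)
  case (Suc k)
  obtain f' where f': "\<And>i p. i \<in> Basis \<Longrightarrow> ((\<lambda>s. f (p + s *\<^sub>R i)) has_vector_derivative f' i p) (at 0)"
    "\<And>i. i \<in> Basis \<Longrightarrow> Ck k (f' i)" using Ck_SucE[OF Suc.prems(1)] by blast
  obtain g' where g': "\<And>i p. i \<in> Basis \<Longrightarrow> ((\<lambda>s. g (p + s *\<^sub>R i)) has_vector_derivative g' i p) (at 0)"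
    "\<And>i. i \<in> Basis \<Longrightarrow> Ck k (g' i)" using Ck_SucE[OF Suc.prems(2)] by blast
  have "\<exists>h. (\<forall>p. ((\<lambda>s. prod (f (p + s *\<^sub>R i)) (g (p + s *\<^sub>R i))) has_vector_derivative h p) (at 0)) \<and> Ck k h"
    if "i \<in> Basis" for i
  proof (intro exI conjI allI)
    show "((\<lambda>s. prod (f (p + s *\<^sub>R i)) (g (p + s *\<^sub>R i))) has_vector_derivative
       prod (f p) (g' i p) + prod (f' i p) (g p)) (at 0)" for p
      using has_vector_derivative[OF f'(1) g'(1), OF that that, of p p] by simp
    show "Ck k (\<lambda>p. prod (f p) (g' i p) + prod (f' i p) (g p))"
      by (intro Ck_add Suc.IH Suc.prems[THEN Ck_SucD] f'(2) g'(2) that)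
  qed
  moreover have "continuous_on UNIV (\<lambda>p. prod (f p) (g p))"
    using Suc.prems by (auto intro: continuous_on)
  ultimately show ?case by simp
qed (auto intro: continuous_on)

text \<open>The partials of \<open>g\<close> are continuous, so
  \<open>has_derivative_from_partials\<close> makes the chain rule available. The derivative of the
  composite contains partials of \<open>g\<close> composed with the same \<open>c\<close>; hence
  only \<open>g\<close> is generalised in the induction.\<close>

lemma Ck_compose:
  assumes "Ck k g" "Ck k c" shows "Ck k (\<lambda>p. g (c p))"
  using assms
proof (induction k arbitrary: g)
  case 0
  then show ?case by (auto intro: continuous_on_compose2[of UNIV g])
next
  case (Suc k)
  obtain g' where g': "\<And>i p. i \<in> Basis \<Longrightarrow> ((\<lambda>s. g (p + s *\<^sub>R i)) has_vector_derivative g' i p) (at 0)"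
    "\<And>i. i \<in> Basis \<Longrightarrow> Ck k (g' i)" using Ck_SucE[OF Suc.prems(1)] by blast
  obtain c' where c': "\<And>i p. i \<in> Basis \<Longrightarrow> ((\<lambda>s. c (p + s *\<^sub>R i)) has_vector_derivative c' i p) (at 0)"
    "\<And>i. i \<in> Basis \<Longrightarrow> Ck k (c' i)" using Ck_SucE[OF Suc.prems(2)] by blast
  have D: "(g has_derivative (\<lambda>h. \<Sum>i\<in>Basis. (h \<bullet> i) *\<^sub>R g' i p)) (at p)" for p
    using g'(1) Ck_imp_continuous[OF g'(2)]
    by (intro has_derivative_from_partials) (auto simp: continuous_on_eq_continuous_at)
  have "\<exists>h. (\<forall>p. ((\<lambda>s. g (c (p + s *\<^sub>R i))) has_vector_derivative h p) (at 0)) \<and> Ck k h"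
    if i: "i \<in> Basis" for i
  proof (intro exI conjI allI)
    fix p
    have "(g has_derivative (\<lambda>h. \<Sum>j\<in>Basis. (h \<bullet> j) *\<^sub>R g' j (c p))) (at (c (p + 0 *\<^sub>R i)))"
      using D[of "c p"] by simp
    from vector_derivative_diff_chain_within[OF c'(1)[OF i] has_derivative_at_withinI[OF this]]
    show "((\<lambda>s. g (c (p + s *\<^sub>R i))) has_vector_derivative (\<Sum>j\<in>Basis. (c' i p \<bullet> j) *\<^sub>R g' j (c p))) (at 0)"
      by (simp add: o_def)
  next
    show "Ck k (\<lambda>p. \<Sum>j\<in>Basis. (c' i p \<bullet> j) *\<^sub>R g' j (c p))"
      by (intro Ck_sum bounded_bilinear.Ck_prod[OF bounded_bilinear_scaleR]
          Ck_linear_compose[OF bounded_linear_inner_left] c'(2) i Suc.IH g'(2) Suc.prems(2)[THEN Ck_SucD])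
  qed
  moreover have "continuous_on UNIV (\<lambda>p. g (c p))"
    using Suc.prems by (auto intro: continuous_on_compose2[of UNIV g])
  ultimately show ?case by simp
qed

section \<open>Closure properties of smooth functions\<close>

lemma smooth_const: "smooth (\<lambda>_. c)"
  and smooth_add: "smooth f \<Longrightarrow> smooth g \<Longrightarrow> smooth (\<lambda>p. f p + g p)"
  and smooth_linear: "bounded_linear L \<Longrightarrow> smooth L"
  and smooth_linear_compose: "bounded_linear K \<Longrightarrow> smooth f \<Longrightarrow> smooth (\<lambda>p. K (f p))"
  and smooth_compose: "smooth h \<Longrightarrow> smooth u \<Longrightarrow> smooth (\<lambda>p. h (u p))"
  by (auto simp: smooth_iff_Ck intro: Ck_const Ck_add Ck_linear Ck_linear_compose Ck_compose)

lemma smooth_mult: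
  fixes f g :: "'a::euclidean_space \<Rightarrow> 'b::real_normed_algebra"
  shows "smooth f \<Longrightarrow> smooth g \<Longrightarrow> smooth (\<lambda>p. f p * g p)"
  by (auto simp: smooth_iff_Ck intro: bounded_bilinear.Ck_prod[OF bounded_bilinear_mult])

lemma smooth_minus: "smooth f \<Longrightarrow> smooth (\<lambda>p. - f p)"
  by (rule smooth_linear_compose[OF bounded_linear_minus[OF bounded_linear_ident]])

lemma smooth_diff: "smooth f \<Longrightarrow> smooth g \<Longrightarrow> smooth (\<lambda>p. f p - g p)"
  using smooth_add[of f "\<lambda>p. - g p"] smooth_minus[of g] by simp

lemma smooth_power:
  fixes f :: "'a::euclidean_space \<Rightarrow> 'b::real_normed_algebra_1"
  shows "smooth f \<Longrightarrow> smooth (\<lambda>p. f p ^ n)"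
  by (induction n) (auto intro: smooth_const smooth_mult)

lemma smooth_divide_const:
  fixes f :: "'a::euclidean_space \<Rightarrow> 'b::real_normed_field"
  shows "smooth f \<Longrightarrow> smooth (\<lambda>p. f p / c)"
  using smooth_mult[OF _ smooth_const, of f "inverse c"] by (simp add: field_simps)

lemma smooth_Pair:
  assumes "smooth f" "smooth g" shows "smooth (\<lambda>p. (f p, g p))"
proof -
  have "smooth (\<lambda>p. (f p, 0) + (0, g p))"
    using assms by (intro smooth_add smooth_linear_compose[of "\<lambda>u. (u, 0)"] smooth_linear_compose[of "\<lambda>u. (0, u)"]
        bounded_linear_Pair bounded_linear_ident bounded_linear_zero)
  then show ?thesis by simp
qed

lemma smooth_fst: "smooth f \<Longrightarrow> smooth (\<lambda>p. fst (f p))"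
  and smooth_snd: "smooth g \<Longrightarrow> smooth (\<lambda>p. snd (g p))"
  and smooth_of_real: "smooth r \<Longrightarrow> smooth (\<lambda>p. complex_of_real (r p))"
  and smooth_Re: "smooth z \<Longrightarrow> smooth (\<lambda>p. Re (z p))"
  and smooth_Im: "smooth z \<Longrightarrow> smooth (\<lambda>p. Im (z p))"
  and smooth_ident: "smooth (\<lambda>p. p)"
  by (auto intro: smooth_linear_compose smooth_linear bounded_linear_fst bounded_linear_snd
      bounded_linear_of_real bounded_linear_Re bounded_linear_Im bounded_linear_ident)

lemmas smooth_intros = smooth_const smooth_add smooth_mult smooth_minus smooth_diff smooth_power
  smooth_divide_const smooth_Pair smooth_fst smooth_snd smooth_of_real smooth_Re smooth_Im smooth_ident

section \<open>Partial derivatives and the chain rule\<close>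

definition pd :: "'a::euclidean_space \<Rightarrow> ('a \<Rightarrow> 'b::real_normed_vector) \<Rightarrow> 'a \<Rightarrow> 'b" where
  "pd i f p = vector_derivative (\<lambda>s. f (p + s *\<^sub>R i)) (at 0)"

lemma smooth_pdE:
  assumes "smooth f" "i \<in> Basis"
  shows "((\<lambda>s. f (p + s *\<^sub>R i)) has_vector_derivative pd i f p) (at 0)" "smooth (pd i f)"
proof -
  obtain g where g: "\<And>p. ((\<lambda>s. f (p + s *\<^sub>R i)) has_vector_derivative g p) (at 0)" "smooth g"
    using smooth.cases[OF assms(1)] assms(2) by metis
  have "pd i f = g" unfolding pd_def using vector_derivative_at[OF g(1)] by blast
  then show "((\<lambda>s. f (p + s *\<^sub>R i)) has_vector_derivative pd i f p) (at 0)" "smooth (pd i f)"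
    using g by auto
qed

lemma smooth_imp_continuous: "smooth f \<Longrightarrow> continuous_on S f"
  using smooth_imp_Ck[of f 0] continuous_on_subset by auto

lemma smooth_has_derivative:
  assumes "smooth f"
  shows "(f has_derivative (\<lambda>h. \<Sum>i\<in>Basis. (h \<bullet> i) *\<^sub>R pd i f p)) (at p)"
  using smooth_pdE(1)[OF assms] smooth_imp_continuous[OF smooth_pdE(2)[OF assms], of _ UNIV]
  by (intro has_derivative_from_partials) (auto simp: continuous_on_eq_continuous_at)

lemma smooth_chain:
  assumes "smooth f" "(c has_vector_derivative c') (at s)"
  shows "((\<lambda>s. f (c s)) has_vector_derivative (\<Sum>i\<in>Basis. (c' \<bullet> i) *\<^sub>R pd i f (c s))) (at s)"
  using vector_derivative_diff_chain_within[OF assms(2)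
      has_derivative_at_withinI[OF smooth_has_derivative[OF assms(1)]]]
  by (simp add: o_def)

section \<open>Calculus in two and three variables\<close>

abbreviation smooth2 :: "(real \<Rightarrow> real \<Rightarrow> complex) \<Rightarrow> bool" where
  "smooth2 f \<equiv> smooth (\<lambda>p. f (fst p) (snd p))"

abbreviation smooth3 :: "(real \<Rightarrow> real \<Rightarrow> complex \<Rightarrow> 'b::real_normed_vector) \<Rightarrow> bool" where
  "smooth3 g \<equiv> smooth (\<lambda>p. g (fst p) (fst (snd p)) (snd (snd p)))"

lemma Basis_real_real: "(Basis :: (real \<times> real) set) = {(1,0), (0,1)}"
  by (auto simp: Basis_prod_def)

lemma Basis_real_real_complex:
  "(Basis :: (real \<times> real \<times> complex) set) = {(1,0,0), (0,1,0), (0,0,1), (0,0,\<i>)}"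
  by (auto simp: Basis_prod_def Basis_complex_def zero_prod_def)

lemma smooth2_dt:
  assumes "smooth2 f"
  shows "((\<lambda>s. f s x) has_vector_derivative dt f t x) (at t)" "smooth2 (dt f)"
proof -
  have *: "((\<lambda>s. f s x) has_vector_derivative pd (1,0) (\<lambda>p. f (fst p) (snd p)) (t,x)) (at t)" for t x
    using smooth_chain[OF assms, of "\<lambda>s. (s,x)" "(1,0)" t]
    by (simp add: Basis_real_real has_vector_derivative_Pair)
  have "dt f t x = pd (1,0) (\<lambda>p. f (fst p) (snd p)) (t,x)" for t x
    unfolding dt_def by (rule vector_derivative_at[OF *])
  then show "((\<lambda>s. f s x) has_vector_derivative dt f t x) (at t)" "smooth2 (dt f)"
    using * smooth_pdE(2)[OF assms, of "(1,0)"] by (auto simp: Basis_real_real)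
qed

lemma smooth2_dx:
  assumes "smooth2 f"
  shows "((\<lambda>s. f t s) has_vector_derivative dx f t x) (at x)" "smooth2 (dx f)"
proof -
  have *: "((\<lambda>s. f t s) has_vector_derivative pd (0,1) (\<lambda>p. f (fst p) (snd p)) (t,x)) (at x)" for t x
    using smooth_chain[OF assms, of "\<lambda>s. (t,s)" "(0,1)" x]
    by (simp add: Basis_real_real has_vector_derivative_Pair)
  have "dx f t x = pd (0,1) (\<lambda>p. f (fst p) (snd p)) (t,x)" for t x
    unfolding dx_def by (rule vector_derivative_at[OF *])
  then show "((\<lambda>s. f t s) has_vector_derivative dx f t x) (at x)" "smooth2 (dx f)"
    using * smooth_pdE(2)[OF assms, of "(0,1)"] by (auto simp: Basis_real_real)
qed

lemma dt_eqI: "(\<And>t x. ((\<lambda>s. f s x) has_vector_derivative f' t x) (at t)) \<Longrightarrow> dt f = f'"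
  unfolding dt_def fun_eq_iff using vector_derivative_at by blast

lemma dx_eqI: "(\<And>t x. ((\<lambda>s. f t s) has_vector_derivative f' t x) (at x)) \<Longrightarrow> dx f = f'"
  unfolding dx_def fun_eq_iff using vector_derivative_at by blast

text \<open>Schwarz's theorem, by differentiating the fundamental theorem of calculus
  in \<open>x\<close> under the integral sign.\<close>

lemma dt_dx_commute:
  assumes f: "smooth2 f"
  shows "dx (dt f) = dt (dx f)"
proof (rule dx_eqI)
  fix t x :: real
  \<comment> \<open>Any interval with \<open>x\<close> in its interior would do: the derivative of
    the integral within \<open>{a..b}\<close> is then a two-sided derivative at
    \<open>x\<close>.\<close>
  define a where "a = x - 1"
  define b where "b = x + 1"
  let ?g = "dx f"
  have g: "smooth2 ?g" by (rule smooth2_dx[OF f])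
  have cont: "continuous_on A (\<lambda>y. h s y)" if "smooth2 h" for s A and h :: "real \<Rightarrow> real \<Rightarrow> complex"
  proof -
    have "smooth (\<lambda>y. h s y)"
      using smooth_compose[OF that, of "\<lambda>y. (s, y)"] by (simp add: smooth_intros)
    then show ?thesis by (rule smooth_imp_continuous)
  qed
  have I: "integral {a..y} (?g s) = f s y - f s a" if "y \<in> {a..b}" for s y
    using that by (intro integral_unique)
      (auto intro!: fundamental_theorem_of_calculus has_vector_derivative_at_within smooth2_dx f)
  \<comment> \<open>Both sides are the \<open>t\<close>-derivative of \<open>f t y - f t a\<close>:
    one directly, the other by the Leibniz rule applied to the integral in \<open>I\<close>.\<close>
  have J: "dt f t y - dt f t a = integral {a..y} (dt ?g t)" if y: "y \<in> {a..b}" for y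
  proof -
    have "((\<lambda>s. integral (cbox a y) (?g s)) has_vector_derivative integral (cbox a y) (dt ?g t)) (at t within UNIV)"
    proof (rule leibniz_rule_vector_derivative)
      show "continuous_on (UNIV \<times> cbox a y) (\<lambda>(s, y). dt ?g s y)"
        using smooth_imp_continuous[OF smooth2_dt(2)[OF g]] by (simp add: case_prod_beta)
    qed (auto intro!: smooth2_dt g integrable_continuous_real cont)
    then have "((\<lambda>s. f s y - f s a) has_vector_derivative integral {a..y} (dt ?g t)) (at t)"
      by (simp add: I[OF y])
    moreover have "((\<lambda>s. f s y - f s a) has_vector_derivative dt f t y - dt f t a) (at t)"
      by (intro has_vector_derivative_diff smooth2_dt f)
    ultimately show ?thesis using vector_derivative_unique_at by blast
  qed
  have x: "x \<in> {a<..<b}" by (simp add: a_def b_def)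
  have "((\<lambda>y. integral {a..y} (dt ?g t)) has_vector_derivative dt ?g t x) (at x within {a..b})"
    using x by (intro integral_has_vector_derivative cont smooth2_dt g) auto
  then have "((\<lambda>y. integral {a..y} (dt ?g t)) has_vector_derivative dt ?g t x) (at x)"
    using x at_within_Icc_at[of a x b] by simp
  then have "((\<lambda>y. integral {a..y} (dt ?g t) + dt f t a) has_vector_derivative dt ?g t x) (at x)"
    by (auto intro!: derivative_eq_intros)
  then show "(dt f t has_vector_derivative dt ?g t x) (at x)"
    by (rule has_vector_derivative_transform_within_open[where S = "{a<..<b}"])
      (use x in \<open>auto simp flip: J\<close>)
qed

lemma dt_simps:
  assumes "smooth2 f" "smooth2 g"
  shows "dt (\<lambda>t x. f t x + g t x) = (\<lambda>t x. dt f t x + dt g t x)"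
    "dt (\<lambda>t x. f t x - g t x) = (\<lambda>t x. dt f t x - dt g t x)"
    "dt (\<lambda>t x. f t x * g t x) = (\<lambda>t x. f t x * dt g t x + dt f t x * g t x)"
  by (rule dt_eqI; intro has_vector_derivative_add has_vector_derivative_diff has_vector_derivative_mult
      smooth2_dt assms)+

lemma dx_simps:
  assumes "smooth2 f" "smooth2 g"
  shows "dx (\<lambda>t x. f t x + g t x) = (\<lambda>t x. dx f t x + dx g t x)"
    "dx (\<lambda>t x. f t x - g t x) = (\<lambda>t x. dx f t x - dx g t x)"
    "dx (\<lambda>t x. f t x * g t x) = (\<lambda>t x. f t x * dx g t x + dx f t x * g t x)"
  by (rule dx_eqI; intro has_vector_derivative_add has_vector_derivative_diff has_vector_derivative_mult
      smooth2_dx assms)+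

lemma dt_dx_const: "dt (\<lambda>t x. c) = (\<lambda>t x. 0)" "dx (\<lambda>t x. c) = (\<lambda>t x. 0)"
  "dx (\<lambda>t x. g t) = (\<lambda>t x. 0)" "dt (\<lambda>t x. h x) = (\<lambda>t x. 0)"
  by (auto intro!: dt_eqI dx_eqI)

lemma dt_dx_Re_Im:
  assumes "smooth2 f"
  shows "dt (\<lambda>t x. complex_of_real (Re (f t x))) = (\<lambda>t x. complex_of_real (Re (dt f t x)))"
    "dt (\<lambda>t x. complex_of_real (Im (f t x))) = (\<lambda>t x. complex_of_real (Im (dt f t x)))"
    "dx (\<lambda>t x. complex_of_real (Re (f t x))) = (\<lambda>t x. complex_of_real (Re (dx f t x)))"
    "dx (\<lambda>t x. complex_of_real (Im (f t x))) = (\<lambda>t x. complex_of_real (Im (dx f t x)))"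
  by (rule dt_eqI dx_eqI;
      intro bounded_linear.has_vector_derivative[OF bounded_linear_of_real]
        bounded_linear.has_vector_derivative[OF bounded_linear_Re]
        bounded_linear.has_vector_derivative[OF bounded_linear_Im] smooth2_dt smooth2_dx assms)+

lemma smooth_deriv:
  fixes r :: "real \<Rightarrow> real"
  assumes "smooth r"
  shows "(r has_real_derivative deriv r t) (at t)" "smooth (deriv r)"
proof -
  have *: "(r has_real_derivative pd 1 r t) (at t)" for t
    using smooth_chain[OF assms, of "\<lambda>s. s" 1 t]
    by (simp add: has_real_derivative_iff_has_vector_derivative)
  then have "deriv r = pd 1 r" using DERIV_imp_deriv by blast
  then show "(r has_real_derivative deriv r t) (at t)" "smooth (deriv r)"
    using * smooth_pdE(2)[OF assms, of 1] by auto
qed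

lemma dt_of_real:
  assumes "\<And>t. (r has_real_derivative r' t) (at t)"
  shows "dt (\<lambda>t x. complex_of_real (r t)) = (\<lambda>t x. complex_of_real (r' t))"
  using assms by (intro dt_eqI bounded_linear.has_vector_derivative[OF bounded_linear_of_real])
    (simp add: has_real_derivative_iff_has_vector_derivative)

lemma dx_of_real:
  assumes "\<And>t. (r has_real_derivative r' t) (at t)"
  shows "dx (\<lambda>t x. complex_of_real (r x)) = (\<lambda>t x. complex_of_real (r' x))"
  using assms by (intro dx_eqI bounded_linear.has_vector_derivative[OF bounded_linear_of_real])
    (simp add: has_real_derivative_iff_has_vector_derivative)

section \<open>Derivatives of functions of (t, x, \<psi>) along a function of (t, x)\<close>

definition D3 :: "real \<times> real \<times> complex \<Rightarrow> (real \<Rightarrow> real \<Rightarrow> complex \<Rightarrow> complex) \<Rightarrow> real \<Rightarrow> real \<Rightarrow> complex \<Rightarrow> complex"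
  where "D3 v g t x z = pd v (\<lambda>p. g (fst p) (fst (snd p)) (snd (snd p))) (t, x, z)"

abbreviation "Dt \<equiv> D3 (1, 0, 0)"
abbreviation "Dx \<equiv> D3 (0, 1, 0)"
text \<open>The real directions 1 and \<i> in the plane of \<psi> replace the pair \<psi>, \<psi>*.
  Independence of \<psi>* is the Cauchy-Riemann equation \<open>Dq g = \<i> * Dp g\<close>.\<close>

abbreviation "Dp \<equiv> D3 (0, 0, 1)"
abbreviation "Dq \<equiv> D3 (0, 0, \<i>)"

lemma smooth3_D3:
  assumes "smooth3 g"
  shows "smooth3 (Dt g)" "smooth3 (Dx g)" "smooth3 (Dp g)" "smooth3 (Dq g)"
  using smooth_pdE(2)[OF assms] by (auto simp: D3_def Basis_real_real_complex)

lemma smooth3_chain: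
  assumes g: "smooth3 g"
    and "(u has_vector_derivative u') (at s)" "(v has_vector_derivative v') (at s)"
    and "(w has_vector_derivative w') (at s)"
  shows "((\<lambda>s. g (u s) (v s) (w s)) has_vector_derivative
    of_real u' * Dt g (u s) (v s) (w s) + of_real v' * Dx g (u s) (v s) (w s)
     + of_real (Re w') * Dp g (u s) (v s) (w s) + of_real (Im w') * Dq g (u s) (v s) (w s)) (at s)"
  using smooth_chain[OF g has_vector_derivative_Pair[OF assms(2) has_vector_derivative_Pair[OF assms(3,4)]]]
  by (simp add: Basis_real_real_complex D3_def scaleR_conv_of_real inner_complex_def add.assoc)

definition along :: "(real \<Rightarrow> real \<Rightarrow> complex \<Rightarrow> complex) \<Rightarrow> (real \<Rightarrow> real \<Rightarrow> complex) \<Rightarrow> real \<Rightarrow> real \<Rightarrow> complex"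
  where "along g f t x = g t x (f t x)"

lemma smooth2_along: "smooth3 g \<Longrightarrow> smooth2 f \<Longrightarrow> smooth2 (along g f)"
  unfolding along_def
  using smooth_compose[of "\<lambda>p. g (fst p) (fst (snd p)) (snd (snd p))" "\<lambda>p. (fst p, snd p, f (fst p) (snd p))"]
  by (simp add: smooth_intros)

lemma dt_along:
  assumes "smooth3 g" "smooth2 f"
  shows "dt (along g f) = (\<lambda>t x. along (Dt g) f t x + of_real (Re (dt f t x)) * along (Dp g) f t x
    + of_real (Im (dt f t x)) * along (Dq g) f t x)"
proof (rule dt_eqI)
  show "((\<lambda>s. along g f s x) has_vector_derivative along (Dt g) f t x
      + of_real (Re (dt f t x)) * along (Dp g) f t x + of_real (Im (dt f t x)) * along (Dq g) f t x) (at t)" for t x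
    unfolding along_def
    using smooth3_chain[OF assms(1) _ _ smooth2_dt(1)[OF assms(2)], of "\<lambda>s. s" 1 t "\<lambda>_. x" 0 x] by simp
qed

lemma dx_along:
  assumes "smooth3 g" "smooth2 f"
  shows "dx (along g f) = (\<lambda>t x. along (Dx g) f t x + of_real (Re (dx f t x)) * along (Dp g) f t x
    + of_real (Im (dx f t x)) * along (Dq g) f t x)"
proof (rule dx_eqI)
  show "((\<lambda>s. along g f t s) has_vector_derivative along (Dx g) f t x
      + of_real (Re (dx f t x)) * along (Dp g) f t x + of_real (Im (dx f t x)) * along (Dq g) f t x) (at x)" for t x
    unfolding along_def
    using smooth3_chain[OF assms(1) _ _ smooth2_dx(1)[OF assms(2)], of "\<lambda>_. t" 0 x "\<lambda>s. s" 1 t] by simp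
qed

lemmas smooth2_simps = smooth_intros smooth2_dt(2) smooth2_dx(2)

text \<open>Differentiating \<Phi> yields the negatives of the two added terms, the mixed one up to
  the order of differentiation, which \<open>dt_dx_commute\<close> settles. The third derivatives in
  \<open>prolongation_xx\<close> cancel in the same way.\<close>

lemma prolongation_t:
  assumes [simp]: "smooth2 N" "smooth2 T" "smooth2 X" "smooth2 f"
  defines "\<Phi> \<equiv> \<lambda>t x. N t x - T t x * dt f t x - X t x * dx f t x"
  shows "dt \<Phi> t x + T t x * dt (dt f) t x + X t x * dx (dt f) t x
    = dt N t x - dt T t x * dt f t x - dt X t x * dx f t x"
  unfolding \<Phi>_def
  by (simp add: dt_simps smooth2_simps dt_dx_commute algebra_simps)

lemma prolongation_xx:
  assumes [simp]: "smooth2 N" "smooth2 T" "smooth2 X" "smooth2 f"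
  defines "\<Phi> \<equiv> \<lambda>t x. N t x - T t x * dt f t x - X t x * dx f t x"
  shows "dx (dx \<Phi>) t x + T t x * dt (dx (dx f)) t x + X t x * dx (dx (dx f)) t x
    = dx (dx N) t x - dx (dx T) t x * dt f t x - dx (dx X) t x * dx f t x
      - 2 * dx T t x * dt (dx f) t x - 2 * dx X t x * dx (dx f) t x"
  unfolding \<Phi>_def
  by (simp add: dx_simps smooth2_simps dt_dx_commute algebra_simps)

section \<open>The determining equations\<close>

text \<open>The second prolongation of the field applied to the equation, where \<open>T\<close>, \<open>X\<close>, \<open>N\<close> are the
  components \<open>\<tau>\<close>, \<open>\<xi>\<close>, \<open>\<eta>\<close> evaluated along \<open>f\<close>.\<close>

definition defect :: "(real \<Rightarrow> real) \<Rightarrow> (real \<Rightarrow> real \<Rightarrow> complex) \<Rightarrow> (real \<Rightarrow> real \<Rightarrow> complex) \<Rightarrow>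
    (real \<Rightarrow> real \<Rightarrow> complex) \<Rightarrow> (real \<Rightarrow> real \<Rightarrow> complex) \<Rightarrow> real \<Rightarrow> real \<Rightarrow> complex" where
  "defect \<gamma> T X N f t x =
     \<i> * (dt N t x - dt T t x * dt f t x - dt X t x * dx f t x)
     + (dx (dx N) t x - dx (dx T) t x * dt f t x - dx (dx X) t x * dx f t x
        - 2 * dx T t x * dt (dx f) t x - 2 * dx X t x * dx (dx f) t x)
     + \<i> * of_real (\<gamma> t * x) * N t x
     + \<i> * (T t x * of_real (deriv \<gamma> t * x) + X t x * of_real (\<gamma> t)) * f t x"

text \<open>Replaces the characteristic by an expression free of third derivatives of
  \<open>f\<close>. Making \<tau> and \<xi> complex-valued lets one calculus serve all three
  components.\<close>

lemma is_lie_symmetry_iff_defect: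
  fixes \<tau> \<xi> :: "real \<Rightarrow> real \<Rightarrow> complex \<Rightarrow> real"
  defines "T \<equiv> \<lambda>t x z. complex_of_real (\<tau> t x z)" and "X \<equiv> \<lambda>t x z. complex_of_real (\<xi> t x z)"
  shows "is_lie_symmetry \<gamma> (\<tau>, \<xi>, \<eta>) \<longleftrightarrow> smooth3 \<tau> \<and> smooth3 \<xi> \<and> smooth3 \<eta> \<and>
    (\<forall>f t x. smooth2 f \<longrightarrow> eqop \<gamma> f t x = 0 \<longrightarrow>
       defect \<gamma> (along T f) (along X f) (along \<eta> f) f t x = 0)"
proof -
  have smooth: "vf_smooth (\<tau>, \<xi>, \<eta>) \<longleftrightarrow> smooth3 \<tau> \<and> smooth3 \<xi> \<and> smooth3 \<eta>"
    by (simp add: vf_smooth_def case_prod_beta')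
  have eq: "\<i> * eta_t (\<tau>, \<xi>, \<eta>) f t x + eta_xx (\<tau>, \<xi>, \<eta>) f t x
          + \<i> * complex_of_real (\<gamma> t * x) * \<eta> t x (f t x)
          + \<i> * complex_of_real (\<tau> t x (f t x) * deriv \<gamma> t * x + \<xi> t x (f t x) * \<gamma> t) * f t x
        = defect \<gamma> (along T f) (along X f) (along \<eta> f) f t x"
    if "smooth3 \<tau>" "smooth3 \<xi>" "smooth3 \<eta>" and f: "smooth2 f" for f t x
  proof -
    have "smooth3 T" "smooth3 X" unfolding T_def X_def using that by (auto intro: smooth_of_real)
    then have s: "smooth2 (along \<eta> f)" "smooth2 (along T f)" "smooth2 (along X f)"
      using that smooth2_along by blast+
    have ch: "charac (\<tau>, \<xi>, \<eta>) f
       = (\<lambda>t x. along \<eta> f t x - along T f t x * dt f t x - along X f t x * dx f t x)"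
      by (simp add: fun_eq_iff charac_def along_def T_def X_def)
    have a: "complex_of_real (\<tau> t x (f t x)) = along T f t x"
      "complex_of_real (\<xi> t x (f t x)) = along X f t x" for t x
      by (simp_all add: along_def T_def X_def)
    show ?thesis
      unfolding eta_t_def eta_xx_def prod.case ch a prolongation_t[OF s f] prolongation_xx[OF s f]
        defect_def
      by (simp add: a along_def algebra_simps)
  qed
  have smooth2: "smooth (\<lambda>(t, x). f t x) \<longleftrightarrow> smooth2 f" for f :: "real \<Rightarrow> real \<Rightarrow> complex"
    by (simp add: case_prod_beta')
  show ?thesis
    unfolding is_lie_symmetry_def smooth prod.case smooth2
  proof (intro iffI; elim conjE; intro conjI allI impI; assumption?)
    fix f t x
    assume s: "smooth3 \<tau>" "smooth3 \<xi>" "smooth3 \<eta>" "smooth2 f" and e: "eqop \<gamma> f t x = 0"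
    {
      assume "\<forall>f. smooth2 f \<longrightarrow> (\<forall>t x. eqop \<gamma> f t x = 0 \<longrightarrow>
        \<i> * eta_t (\<tau>, \<xi>, \<eta>) f t x + eta_xx (\<tau>, \<xi>, \<eta>) f t x
          + \<i> * complex_of_real (\<gamma> t * x) * \<eta> t x (f t x)
          + \<i> * complex_of_real (\<tau> t x (f t x) * deriv \<gamma> t * x + \<xi> t x (f t x) * \<gamma> t) * f t x = 0)"
      with s(4) e show "defect \<gamma> (along T f) (along X f) (along \<eta> f) f t x = 0"
        unfolding eq[OF s, symmetric] by blast
    next
      assume "\<forall>f t x. smooth2 f \<longrightarrow> eqop \<gamma> f t x = 0 \<longrightarrow>
        defect \<gamma> (along T f) (along X f) (along \<eta> f) f t x = 0"
      with s(4) e show "\<i> * eta_t (\<tau>, \<xi>, \<eta>) f t x + eta_xx (\<tau>, \<xi>, \<eta>) f t x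
          + \<i> * complex_of_real (\<gamma> t * x) * \<eta> t x (f t x)
          + \<i> * complex_of_real (\<tau> t x (f t x) * deriv \<gamma> t * x + \<xi> t x (f t x) * \<gamma> t) * f t x = 0"
        unfolding eq[OF s] by blast
    }
  qed
qed

text \<open>The witness is a Taylor polynomial centred at the point. It prescribes exactly the jet
  entries that occur in \<open>defect\<close>; the second \<open>t\<close>-derivative does not occur
  there.\<close>

lemma smooth2_ex_jet:
  fixes a b c d e :: complex
  obtains f where "smooth2 f" "f t0 x0 = a" "dx f t0 x0 = b" "dx (dx f) t0 x0 = c"
    "dt f t0 x0 = d" "dt (dx f) t0 x0 = e"
proof
  \<comment> \<open>Half of \<open>c\<close>, because the second derivative of a square contributes
    a factor 2.\<close>
  define c' where "c' = c / 2"
  let ?X = "\<lambda>x. complex_of_real (x - x0)" and ?T = "\<lambda>t. complex_of_real (t - t0)"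
  let ?f = "\<lambda>t x. a + b * ?X x + c' * (?X x * ?X x) + d * ?T t + e * (?T t * ?X x)"
  have D: "((\<lambda>s. s - y) has_real_derivative 1) (at s)" for s y :: real
    by (auto intro!: derivative_eq_intros)
  note simps = dt_simps dx_simps dt_dx_const smooth_intros dt_of_real[OF D] dx_of_real[OF D]
  have fx: "dx ?f = (\<lambda>t x. b + c' * (?X x + ?X x) + e * ?T t)"
    by (simp add: simps del: of_real_diff)
  show "smooth2 ?f" by (intro smooth_intros)
  show "?f t0 x0 = a" by simp
  show "dx ?f t0 x0 = b" unfolding fx by simp
  show "dt ?f t0 x0 = d" by (simp add: simps del: of_real_diff)
  show "dx (dx ?f) t0 x0 = c" "dt (dx ?f) t0 x0 = e"
    unfolding fx by (simp_all add: simps c'_def del: of_real_diff)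
qed

lemma dx_dx_along:
  assumes "smooth3 g" "smooth2 f"
  shows "dx (dx (along g f)) t x =
    along (Dx (Dx g)) f t x + of_real (Re (dx f t x)) * along (Dp (Dx g)) f t x
      + of_real (Im (dx f t x)) * along (Dq (Dx g)) f t x
    + of_real (Re (dx (dx f) t x)) * along (Dp g) f t x + of_real (Im (dx (dx f) t x)) * along (Dq g) f t x
    + of_real (Re (dx f t x)) * (along (Dx (Dp g)) f t x + of_real (Re (dx f t x)) * along (Dp (Dp g)) f t x
      + of_real (Im (dx f t x)) * along (Dq (Dp g)) f t x)
    + of_real (Im (dx f t x)) * (along (Dx (Dq g)) f t x + of_real (Re (dx f t x)) * along (Dp (Dq g)) f t x
      + of_real (Im (dx f t x)) * along (Dq (Dq g)) f t x)"
  using assms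
  by (simp add: dx_along smooth3_D3 dx_simps smooth2_along smooth2_simps dt_dx_Re_Im algebra_simps)

lemma D3_at_const:
  "D3 (0, v) (\<lambda>t x z. h t) = (\<lambda>t x z. 0)"
  by (cases v) (simp add: D3_def pd_def fun_eq_iff)

lemma D3_cmult:
  assumes "smooth3 g" "v \<in> Basis"
  shows "D3 v (\<lambda>t x z. c * g t x z) = (\<lambda>t x z. c * D3 v g t x z)"
proof -
  have "((\<lambda>s. c * g (fst (p + s *\<^sub>R v)) (fst (snd (p + s *\<^sub>R v))) (snd (snd (p + s *\<^sub>R v))))
      has_vector_derivative c * pd v (\<lambda>p. g (fst p) (fst (snd p)) (snd (snd p))) p) (at 0)" for p
    using smooth_pdE(1)[OF assms] by (rule has_vector_derivative_mult_right)
  then show ?thesis unfolding D3_def fun_eq_iff pd_def[of v "\<lambda>p. c * _ p"] using vector_derivative_at by blast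
qed

text \<open>The device for integrating determining equations: \<open>c = 0\<close> gives constancy,
  and \<open>y = 1\<close> along a ray compares a value with the one at the origin.\<close>

lemma has_vector_derivative_const_imp_affine:
  fixes h :: "real \<Rightarrow> 'b::real_normed_vector"
  assumes "\<And>s. (h has_vector_derivative c) (at s)"
  shows "h y = h 0 + y *\<^sub>R c"
proof -
  have "((\<lambda>s. h s - s *\<^sub>R c) has_vector_derivative 0) (at s within UNIV)" for s
    using assms by (auto intro!: derivative_eq_intros)
  then obtain k where "\<And>s. h s - s *\<^sub>R c = k"
    using has_vector_derivative_zero_constant[of UNIV "\<lambda>s. h s - s *\<^sub>R c"] by auto
  then show ?thesis by (metis diff_add_cancel diff_zero scale_zero_left)
qed

lemma has_vector_derivative_line:
  "((\<lambda>s. s * x) has_vector_derivative (x::real)) (at s)"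
  "((\<lambda>s. complex_of_real s * z) has_vector_derivative z) (at s)"
proof -
  have "((\<lambda>s. s *\<^sub>R v) has_vector_derivative v) (at s)" for v :: "'a::real_normed_vector"
    by (auto intro!: derivative_eq_intros)
  from this[of x] this[of z] show "((\<lambda>s. s * x) has_vector_derivative x) (at s)"
    "((\<lambda>s. complex_of_real s * z) has_vector_derivative z) (at s)"
    by (simp_all add: scaleR_conv_of_real)
qed

text \<open>In \<open>det\<close>, the values \<open>a\<close>, \<open>b\<close>, \<open>c\<close>,
  \<open>d\<close>, \<open>e\<close> stand for \<psi> and its derivatives by x, xx, t, tx at one
  point; all are free except \<open>d\<close>, which the equation fixes. Real and imaginary parts of
  \<open>b\<close> and \<open>c\<close> enter separately, so each coefficient is tested with both 1
  and \<i>.\<close>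

lemma symmetry_structure:
  assumes smooth: "smooth3 T" "smooth3 X" "smooth3 N"
    and sym: "\<And>f t x. smooth2 f \<Longrightarrow> eqop \<gamma> f t x = 0 \<Longrightarrow>
      defect \<gamma> (along T f) (along X f) (along N f) f t x = 0"
  shows "T t x z = T t 0 0"
    and "X t x z = X t 0 0 + of_real x * Dt T t 0 0 / 2"
    and "N t x z = N t x 0 + Dp N t x 0 * z"
proof -
  \<comment> \<open>\<open>P g w\<close> is the real-linear derivative of \<open>g\<close> in the
    direction \<open>w\<close> of \<psi>. The second total x-derivative of \<open>g\<close> is
    \<open>B g b + P g c\<close>, with \<open>B\<close> free of the second derivative
    \<open>c\<close>. \<open>R\<close> collects the terms without derivatives of the
    components.\<close>
  define P where "P g w t x z = of_real (Re w) * Dp g t x z + of_real (Im w) * Dq g t x z" for g w t x z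
  define B where "B g b t x z = Dx (Dx g) t x z + P (Dx g) b t x z
     + of_real (Re b) * (Dx (Dp g) t x z + P (Dp g) b t x z)
     + of_real (Im b) * (Dx (Dq g) t x z + P (Dq g) b t x z)" for g b t x z
  define R where "R t x a = \<i> * of_real (\<gamma> t * x) * N t x a
     + \<i> * (T t x a * of_real (deriv \<gamma> t * x) + X t x a * of_real (\<gamma> t)) * a" for t x a
  have P_add: "P g (v + w) t x z = P g v t x z + P g w t x z" for g v w t x z
    by (simp add: P_def algebra_simps)
  have P_0: "P g 0 t x z = 0" for g t x z by (simp add: P_def)
  have det: "\<i> * (Dt N t x a + P N d t x a - (Dt T t x a + P T d t x a) * d - (Dt X t x a + P X d t x a) * b)
     + (B N b t x a + P N c t x a - (B T b t x a + P T c t x a) * d - (B X b t x a + P X c t x a) * b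
        - 2 * (Dx T t x a + P T b t x a) * e - 2 * (Dx X t x a + P X b t x a) * c) + R t x a = 0"
    if "d = \<i> * c + - of_real (\<gamma> t * x) * a" for t x a b c d e
  proof -
    obtain f where f: "smooth2 f" "f t x = a" "dx f t x = b" "dx (dx f) t x = c"
      "dt f t x = d" "dt (dx f) t x = e" using smooth2_ex_jet by blast
    have "eqop \<gamma> f t x = 0" unfolding eqop_def f(2-) that by (simp add: algebra_simps)
    from sym[OF f(1) this] show ?thesis
      unfolding defect_def dx_dx_along[OF smooth(1) f(1)] dx_dx_along[OF smooth(2) f(1)] dx_dx_along[OF smooth(3) f(1)]
      unfolding dt_along[OF smooth(1) f(1)] dt_along[OF smooth(2) f(1)] dt_along[OF smooth(3) f(1)]
        dx_along[OF smooth(1) f(1)] dx_along[OF smooth(2) f(1)] f(3-) along_def f(2)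
      by (simp add: P_def B_def R_def algebra_simps)
  qed
  \<comment> \<open>The difference between \<open>e = 1\<close> and \<open>e = 0\<close> isolates
    the coefficient of the mixed derivative. Next, \<open>b = 0\<close> gives
    \<open>Dx T = 0\<close>, and then \<open>b = 1\<close> and \<open>b = \<i>\<close> remove
    \<open>Dp T\<close> and \<open>Dq T\<close>.\<close>
  have Tb: "Dx T t x a + P T b t x a = 0" for t x a b
    using det[OF refl, where t=t and x=x and a=a and b=b and c=0 and e=0]
      det[OF refl, where t=t and x=x and a=a and b=b and c=0 and e=1] by algebra
  have Tx: "Dx T = (\<lambda>t x z. 0)" and Tp: "Dp T = (\<lambda>t x z. 0)" and Tq: "Dq T = (\<lambda>t x z. 0)"
    using Tb[of _ _ _ 0] Tb[of _ _ _ 1] Tb[of _ _ _ \<i>] by (auto simp: fun_eq_iff P_def)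
  have T: "T t x z = T t 0 0" for t x z
  proof -
    \<comment> \<open>At fixed \<open>t\<close>, integration runs along the ray from the origin to
      (x, z). The same ray serves for \<open>X\<close>, and a ray in the \<psi>-plane serves for
      \<open>N\<close>.\<close>
    have "((\<lambda>s. T t (s * x) (of_real s * z)) has_vector_derivative 0) (at s)" for s
      by (rule has_vector_derivative_eq_rhs[OF smooth3_chain[OF 
          smooth(1) has_vector_derivative_const has_vector_derivative_line]]) (simp add: Tx Tp Tq)
    from has_vector_derivative_const_imp_affine[OF this, of 1] show ?thesis by simp
  qed
  then show "T t x z = T t 0 0" by simp
  define T1 where "T1 t = Dt T t 0 0" for t
  have Tt: "Dt T = (\<lambda>t x z. T1 t)"
  proof (intro ext)
    fix t x z
    have "(\<lambda>p. T (fst p) (fst (snd p)) (snd (snd p))) = (\<lambda>p. T (fst p) 0 0)" using T by blast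
    then have "Dt T t x z = pd (1, 0, 0) (\<lambda>p. T (fst p) 0 0) (t, x, z)"
      "T1 t = pd (1, 0, 0) (\<lambda>p::real \<times> real \<times> complex. T (fst p) 0 0) (t, 0, 0)" by (simp_all only: D3_def T1_def)
    then show "Dt T t x z = T1 t" by (simp add: pd_def)
  qed
  have det: "\<i> * (Dt N t x a + P N d t x a - T1 t * d - (Dt X t x a + P X d t x a) * b)
     + (B N b t x a + P N c t x a - (B X b t x a + P X c t x a) * b
        - 2 * (Dx X t x a + P X b t x a) * c) + R t x a = 0"
    if "d = \<i> * c + - of_real (\<gamma> t * x) * a" for t x a b c d
    using det[OF that, where b=b and e=0] by (simp add: B_def P_def Tx Tp Tq Tt D3_at_const)
  \<comment> \<open>Subtracting the instance \<open>c = 0\<close> leaves what is real-linear in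
    \<open>c\<close>. Since \<open>d\<close> moves with \<open>c\<close> through the equation,
    \<open>\<i> * c\<close> appears in place of a change of \<open>d\<close>.\<close>
  have c_part: "\<i> * (P N (\<i> * c) t x a - T1 t * (\<i> * c) - P X (\<i> * c) t x a * b)
     + (P N c t x a - P X c t x a * b - 2 * (Dx X t x a + P X b t x a) * c) = 0" for t x a b c
    using det[OF refl, where t=t and x=x and a=a and b=b and c=c]
      det[OF refl, where t=t and x=x and a=a and b=b and c=0]
    unfolding P_add mult_zero_right add_0_left P_0 by algebra
  have X: "Dp X t x a = 0" "Dq X t x a = 0" "Dq N t x a = \<i> * Dp N t x a" "Dx X t x a = T1 t / 2" for t x a
  proof -
    \<comment> \<open>At \<open>b = 0\<close>, the instances \<open>c = 1\<close> and
      \<open>c = \<i>\<close> (the latter times \<open>- \<i>\<close>) have the sum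
      \<open>2 * T1 t - 4 * Dx X t x a = 0\<close>; what is left is the Cauchy-Riemann equation for
      \<open>N\<close>.\<close>
    have 1: "\<i> * Dq N t x a + T1 t + Dp N t x a - 2 * Dx X t x a = 0"
      using c_part[where t=t and x=x and a=a and b=0 and c=1] by (simp add: P_def algebra_simps)
    have 2: "- \<i> * Dp N t x a + \<i> * T1 t + Dq N t x a - 2 * \<i> * Dx X t x a = 0"
      using c_part[where t=t and x=x and a=a and b=0 and c=\<i>] by (simp add: P_def algebra_simps)
    \<comment> \<open>Letting \<open>b\<close> be 1 and then \<i> adds terms in \<open>Dp X\<close>
      and \<open>Dq X\<close> only; comparison with \<open>1\<close> gives two independent linear
      equations for them.\<close>
    have 3: "\<i> * Dq N t x a + T1 t - \<i> * Dq X t x a + Dp N t x a - Dp X t x a - 2 * (Dx X t x a + Dp X t x a) = 0"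
      using c_part[where t=t and x=x and a=a and b=1 and c=1] by (simp add: P_def algebra_simps)
    have 4: "\<i> * Dq N t x a + T1 t + Dq X t x a + Dp N t x a - Dp X t x a * \<i> - 2 * (Dx X t x a + Dq X t x a) = 0"
      using c_part[where t=t and x=x and a=a and b=\<i> and c=1] by (simp add: P_def algebra_simps)
    have "- \<i> * (- \<i> * Dp N t x a + \<i> * T1 t + Dq N t x a - 2 * \<i> * Dx X t x a) = 0"
      unfolding 2 by simp
    then have e2: "- Dp N t x a + T1 t - \<i> * Dq N t x a - 2 * Dx X t x a = 0"
      by (simp add: algebra_simps)
    have "2 * T1 t - 4 * Dx X t x a = 0" using 1 e2 by algebra
    then show 5: "Dx X t x a = T1 t / 2" by simp
    have "\<i> * (\<i> * Dq N t x a + Dp N t x a) = 0" using 1 5 by simp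
    then show "Dq N t x a = \<i> * Dp N t x a" by (simp add: algebra_simps)
    have 6: "3 * Dp X t x a + \<i> * Dq X t x a = 0" using 1 3 by algebra
    have 7: "Dq X t x a + \<i> * Dp X t x a = 0" using 1 4 by algebra
    have "3 * Dp X t x a + \<i> * Dq X t x a - \<i> * (Dq X t x a + \<i> * Dp X t x a) = 0"
      unfolding 6 7 by simp
    then show "Dp X t x a = 0" by (simp add: algebra_simps)
    then show "Dq X t x a = 0" using 7 by simp
  qed
  show "X t x z = X t 0 0 + of_real x * Dt T t 0 0 / 2"
  proof -
    have "((\<lambda>s. X t (s * x) (of_real s * z)) has_vector_derivative of_real x * (T1 t / 2)) (at s)" for s
      by (rule has_vector_derivative_eq_rhs[OF smooth3_chain[OF 
          smooth(2) has_vector_derivative_const has_vector_derivative_line]]) (simp add: X)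
    from has_vector_derivative_const_imp_affine[OF this, of 1] show ?thesis by (simp add: T1_def)
  qed
  have Xf: "Dp X = (\<lambda>t x z. 0)" "Dq X = (\<lambda>t x z. 0)" "Dx X = (\<lambda>t x z. T1 t / 2)"
    and Nq: "Dq N = (\<lambda>t x z. \<i> * Dp N t x z)"
    using X by (auto simp: fun_eq_iff)
  have Npq: "Dp (Dq N) = (\<lambda>t x z. \<i> * Dp (Dp N) t x z)" "Dq (Dq N) = (\<lambda>t x z. \<i> * Dq (Dp N) t x z)"
    unfolding Nq using smooth3_D3[OF smooth(3)] by (auto intro!: D3_cmult simp: Basis_real_real_complex)
  \<comment> \<open>A second difference in \<open>b\<close> removes everything constant or linear in
    \<open>b\<close>, in particular the term with \<open>Dt X\<close>. What survives is quadratic in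
    \<open>b\<close> and carries the second \<psi>-derivatives of \<open>N\<close>.\<close>
  have B2: "B N b t x a + B N (-b) t x a = 2 * B N 0 t x a" for b t x a
  proof -
    have X0: "B X b t x a = 0" "P X b t x a = 0" for b t x a by (simp_all add: B_def P_def Xf D3_at_const)
    from det[OF refl, where t=t and x=x and a=a and b=b and c=0]
      det[OF refl, where t=t and x=x and a=a and b="-b" and c=0]
      det[OF refl, where t=t and x=x and a=a and b=0 and c=0] show ?thesis
      unfolding X0 by algebra
  qed
  have Npp: "Dp (Dp N) t x a = 0" for t x a using B2[where b = 1] by (simp add: B_def P_def algebra_simps)
  have Nqp: "Dq (Dp N) t x a = 0" for t x a
    using B2[where b = \<i>] by (simp add: B_def P_def Npq algebra_simps)
  show "N t x z = N t x 0 + Dp N t x 0 * z"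
  proof -
    \<comment> \<open>Both real \<psi>-derivatives of \<open>Dp N\<close> vanish, so it is constant
      in \<psi>. A second integration then makes \<open>N\<close> affine in \<psi>.\<close>
    have const: "Dp N t x w = Dp N t x 0" for w
    proof -
      have "((\<lambda>s. Dp N t x (of_real s * w)) has_vector_derivative 0) (at s)" for s
        by (rule has_vector_derivative_eq_rhs[OF smooth3_chain[OF 
            smooth3_D3(3)[OF smooth(3)] has_vector_derivative_const has_vector_derivative_const has_vector_derivative_line(2)]]) (simp add: Npp Nqp)
      from has_vector_derivative_const_imp_affine[OF this, of 1] show ?thesis by simp
    qed
    have "((\<lambda>s. N t x (of_real s * z)) has_vector_derivative
        of_real (Re z) * Dp N t x 0 + of_real (Im z) * (\<i> * Dp N t x 0)) (at s)" for s
      using const[of "of_real s * z"]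
      by (intro has_vector_derivative_eq_rhs[OF smooth3_chain[OF 
          smooth(3) has_vector_derivative_const has_vector_derivative_const has_vector_derivative_line(2)]]) (simp add: Nq)
    from has_vector_derivative_const_imp_affine[OF this, of 1]
    have "N t x z = N t x 0 + (of_real (Re z) + \<i> * of_real (Im z)) * Dp N t x 0"
      by (simp add: algebra_simps)
    then show ?thesis by (simp flip: complex_eq add: mult.commute)
  qed
qed

section \<open>Fields affine in \<psi>: the remaining conditions\<close>

lemma has_vector_derivative_Complex_parts:
  assumes "(A has_real_derivative A') (at t)" "(B has_real_derivative B') (at t)"
  shows "((\<lambda>s. \<i> * complex_of_real (A s) + complex_of_real (B s)) has_vector_derivative
    \<i> * complex_of_real A' + complex_of_real B') (at t)"
  using assms
  by (intro has_vector_derivative_add has_vector_derivative_mult_right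
      bounded_linear.has_vector_derivative[OF bounded_linear_of_real])
    (auto simp: has_real_derivative_iff_has_vector_derivative)

text \<open>Together with \<open>slope_condition\<close>, these are the coefficients of
  \<open>f\<close> and of \<open>dx f\<close> that survive in \<open>defect\<close> for the reduced
  field.\<close>

definition factor_condition :: "(real \<Rightarrow> real) \<Rightarrow> (real \<Rightarrow> real) \<Rightarrow> (real \<Rightarrow> real) \<Rightarrow>
    (real \<Rightarrow> real \<Rightarrow> complex) \<Rightarrow> real \<Rightarrow> real \<Rightarrow> complex" where
  "factor_condition \<gamma> \<tau> \<sigma> \<eta>1 t x = \<i> * dt \<eta>1 t x + dx (dx \<eta>1) t x
     + \<i> * of_real ((3/2 * deriv \<tau> t * \<gamma> t + \<tau> t * deriv \<gamma> t) * x + \<sigma> t * \<gamma> t)"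

definition slope_condition :: "(real \<Rightarrow> real) \<Rightarrow> (real \<Rightarrow> real) \<Rightarrow>
    (real \<Rightarrow> real \<Rightarrow> complex) \<Rightarrow> real \<Rightarrow> real \<Rightarrow> complex" where
  "slope_condition \<tau> \<sigma> \<eta>1 t x = 2 * dx \<eta>1 t x - \<i> * of_real (deriv \<sigma> t + deriv (deriv \<tau>) t * x / 2)"

text \<open>By \<open>sol\<close>, the terms in which \<eta>1 is undifferentiated cancel. In the
  same way, the terms with \<open>deriv \<tau>\<close> times \<open>dt f\<close> and
  \<open>dx (dx f)\<close> turn into one copy of \<open>deriv \<tau> t * \<gamma> t * x\<close>; the
  slope of the x-component adds half a copy, hence the factor 3/2.\<close>

lemma defect_affine:
  assumes \<tau>: "smooth \<tau>" and \<sigma>: "smooth \<sigma>" and \<eta>: "smooth2 \<eta>0" "smooth2 \<eta>1" and f: "smooth2 f"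
    and sol: "eqop \<gamma> f t x = 0"
  shows "defect \<gamma> (\<lambda>t x. of_real (\<tau> t)) (\<lambda>t x. of_real (\<sigma> t + deriv \<tau> t * x / 2))
      (\<lambda>t x. \<eta>0 t x + \<eta>1 t x * f t x) f t x
    = eqop \<gamma> \<eta>0 t x + f t x * factor_condition \<gamma> \<tau> \<sigma> \<eta>1 t x + dx f t x * slope_condition \<tau> \<sigma> \<eta>1 t x"
proof -
  note \<tau>1 = smooth_deriv[OF \<tau>] and \<sigma>1 = smooth_deriv[OF \<sigma>]
  note \<tau>2 = smooth_deriv[OF \<tau>1(2)]
  let ?X = "\<lambda>t x. complex_of_real (\<sigma> t + deriv \<tau> t * x / 2)"
  have Tt: "dt (\<lambda>t x. complex_of_real (\<tau> t)) = (\<lambda>t x. of_real (deriv \<tau> t))"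
    by (rule dt_of_real[OF \<tau>1(1)])
  have Tx: "dx (\<lambda>t x. complex_of_real (\<tau> t)) = (\<lambda>t x. 0)" "dx (\<lambda>t x. 0) = (\<lambda>t x. 0)"
    by (rule dt_dx_const)+
  have Xt: "dt ?X = (\<lambda>t x. of_real (deriv \<sigma> t + deriv (deriv \<tau>) t * x / 2))"
    by (rule dt_eqI, rule bounded_linear.has_vector_derivative[OF bounded_linear_of_real])
      (auto simp flip: has_real_derivative_iff_has_vector_derivative intro!: derivative_eq_intros \<sigma>1 \<tau>2)
  have Xx: "dx ?X = (\<lambda>t x. of_real (deriv \<tau> t / 2))"
    by (rule dx_eqI, rule bounded_linear.has_vector_derivative[OF bounded_linear_of_real])
      (auto simp flip: has_real_derivative_iff_has_vector_derivative intro!: derivative_eq_intros)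
  have Xxx: "dx (\<lambda>t x. complex_of_real (deriv \<tau> t / 2)) = (\<lambda>t x. 0)" by (rule dt_dx_const)
  have Nt: "dt (\<lambda>t x. \<eta>0 t x + \<eta>1 t x * f t x) t x = dt \<eta>0 t x + \<eta>1 t x * dt f t x + dt \<eta>1 t x * f t x"
    using \<eta> f by (simp add: dt_simps smooth2_simps)
  have Nx: "dx (dx (\<lambda>t x. \<eta>0 t x + \<eta>1 t x * f t x)) t x
    = dx (dx \<eta>0) t x + \<eta>1 t x * dx (dx f) t x + 2 * dx \<eta>1 t x * dx f t x + dx (dx \<eta>1) t x * f t x"
    using \<eta> f by (simp add: dx_simps smooth2_simps)
  have fxx: "dx (dx f) t x = - \<i> * dt f t x - \<i> * of_real (\<gamma> t * x) * f t x"
    using sol unfolding eqop_def by (simp add: eq_neg_iff_add_eq_0 algebra_simps)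
  show ?thesis
    unfolding defect_def Tt Tx Xt Xx Xxx Nt Nx fxx eqop_def factor_condition_def slope_condition_def
    by (simp add: field_simps)
qed

text \<open>The values of \<open>f\<close> and \<open>dx f\<close> at a point are free, as
  \<open>dt f\<close> can be chosen to satisfy the equation there. Hence an expression affine in the
  two vanishes on the solution manifold only if its three coefficients do.\<close>

lemma is_lie_symmetry_affine_iff:
  assumes \<tau>: "smooth \<tau>" and \<sigma>: "smooth \<sigma>" and \<eta>: "smooth2 \<eta>0" "smooth2 \<eta>1"
  shows "is_lie_symmetry \<gamma> (\<lambda>t x z. \<tau> t, \<lambda>t x z. \<sigma> t + deriv \<tau> t * x / 2, \<lambda>t x z. \<eta>0 t x + \<eta>1 t x * z)
    \<longleftrightarrow> (\<forall>t x. eqop \<gamma> \<eta>0 t x = 0 \<and> factor_condition \<gamma> \<tau> \<sigma> \<eta>1 t x = 0 \<and> slope_condition \<tau> \<sigma> \<eta>1 t x = 0)"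
    (is "?L \<longleftrightarrow> ?R")
proof -
  have t: "smooth (\<lambda>p::real \<times> real \<times> complex. r (fst p))" if "smooth r" for r :: "real \<Rightarrow> real"
    by (rule smooth_compose[OF that]) (intro smooth_intros)
  have tx: "smooth (\<lambda>p::real \<times> real \<times> complex. g (fst p) (fst (snd p)))" if "smooth2 g" for g
    using smooth_compose[OF that, of "\<lambda>p::real \<times> real \<times> complex. (fst p, fst (snd p))"]
    by (simp add: smooth_intros)
  have smooth: "smooth3 (\<lambda>t x z. \<tau> t)" "smooth3 (\<lambda>t x z. \<sigma> t + deriv \<tau> t * x / 2)"
    "smooth3 (\<lambda>t x z. \<eta>0 t x + \<eta>1 t x * z)"
    by (intro smooth_intros t tx \<tau> \<sigma> \<eta> smooth_deriv)+
  have along: "along (\<lambda>t x z. of_real (\<tau> t)) f = (\<lambda>t x. of_real (\<tau> t))"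
    "along (\<lambda>t x z. of_real (\<sigma> t + deriv \<tau> t * x / 2)) f = (\<lambda>t x. of_real (\<sigma> t + deriv \<tau> t * x / 2))"
    "along (\<lambda>t x z. \<eta>0 t x + \<eta>1 t x * z) f = (\<lambda>t x. \<eta>0 t x + \<eta>1 t x * f t x)" for f
    by (simp_all add: along_def fun_eq_iff)
  have iff: "?L \<longleftrightarrow> (\<forall>f t x. smooth2 f \<longrightarrow> eqop \<gamma> f t x = 0 \<longrightarrow>
      eqop \<gamma> \<eta>0 t x + f t x * factor_condition \<gamma> \<tau> \<sigma> \<eta>1 t x + dx f t x * slope_condition \<tau> \<sigma> \<eta>1 t x = 0)"
    unfolding is_lie_symmetry_iff_defect along
    by (simp only: smooth defect_affine[OF \<tau> \<sigma> \<eta>] simp_thms cong: imp_cong)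
  show ?thesis
  proof
    assume ?L
    have "eqop \<gamma> \<eta>0 t x + a * factor_condition \<gamma> \<tau> \<sigma> \<eta>1 t x + b * slope_condition \<tau> \<sigma> \<eta>1 t x = 0" for t x a b
    proof -
      obtain f where f: "smooth2 f" "f t x = a" "dx f t x = b" "dx (dx f) t x = 0"
        "dt f t x = - of_real (\<gamma> t * x) * a" "dt (dx f) t x = 0" using smooth2_ex_jet by blast
      have "eqop \<gamma> f t x = 0" unfolding eqop_def f(2-) by (simp add: algebra_simps)
      then show ?thesis using \<open>?L\<close>[unfolded iff] f(1-3) by blast
    qed
    from this[where a = 0 and b = 0] this[where a = 1 and b = 0] this[where a = 0 and b = 1]
    show ?R by simp
  qed (simp add: iff)
qed

section \<open>Symmetries and the span of the generators\<close>

text \<open>The multiplier of \<psi> in a general combination of the generators: \<open>p\<close>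
  belongs to the field D, and \<open>a\<close>, \<open>b\<close>, \<open>m\<close>, \<open>r\<close>
  weight G(1) + \<rho>1 I, G(t) + \<rho>2 I, M and I. \<open>sym_vf\<close> is the resulting normal
  form of a symmetry.\<close>

definition sym_factor :: "(real \<Rightarrow> real) \<Rightarrow> (real \<Rightarrow> real) \<Rightarrow> real poly \<Rightarrow> real \<Rightarrow> real \<Rightarrow> real \<Rightarrow> real \<Rightarrow>
    real \<Rightarrow> real \<Rightarrow> complex" where
  "sym_factor \<rho>1 \<rho>2 p a b m r t x =
     \<i> * of_real (poly (pderiv (pderiv p)) t * x\<^sup>2 / 8 + b * x / 2 + m)
     + of_real (a * \<rho>1 t + b * \<rho>2 t + r - poly (pderiv p) t / 4)"

definition sym_vf :: "(real \<Rightarrow> real) \<Rightarrow> (real \<Rightarrow> real) \<Rightarrow> real poly \<Rightarrow> real \<Rightarrow> real \<Rightarrow> real \<Rightarrow> real \<Rightarrow>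
    (real \<Rightarrow> real \<Rightarrow> complex) \<Rightarrow> vf" where
  "sym_vf \<rho>1 \<rho>2 p a b m r \<eta>0 =
     (\<lambda>t x z. poly p t, \<lambda>t x z. (a + b * t) + poly (pderiv p) t * x / 2,
      \<lambda>t x z. \<eta>0 t x + sym_factor \<rho>1 \<rho>2 p a b m r t x * z)"

lemma smooth_poly: "smooth (poly (p :: real poly))"
proof (induction p)
  case (pCons c p)
  have "smooth (\<lambda>t. c + t * poly p t)" using pCons by (intro smooth_intros) auto
  then show ?case by (simp add: fun_eq_iff poly_pCons cong: arg_cong[where f = smooth])
qed (simp add: smooth_const)

lemma smooth_real_antiderivative:
  fixes r :: "real \<Rightarrow> real"
  assumes "\<And>t. (r has_real_derivative r' t) (at t)" "smooth r'"
  shows "smooth r"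
proof (rule smooth.intros)
  show "continuous_on UNIV r"
    using assms(1) by (intro DERIV_continuous_on) auto
  have "((\<lambda>s. r (p + s *\<^sub>R 1)) has_vector_derivative r' p) (at 0)" for p
    using DERIV_shift[of r "r' p" 0 p] assms(1)[of p]
    by (simp add: has_real_derivative_iff_has_vector_derivative add.commute)
  then show "\<forall>i\<in>Basis. \<exists>g. (\<forall>p. ((\<lambda>s. r (p + s *\<^sub>R i)) has_vector_derivative g p) (at 0)) \<and> smooth g"
    using assms(2) by auto
qed

text \<open>In \<open>factor_condition\<close> the derivatives of \<rho>1 and \<rho>2 cancel
  \<open>(a + b * t) * \<gamma> t\<close>, the term with 1/4 in \<open>sym_factor\<close> cancels
  \<open>dx (dx ?F)\<close>, and the coefficient of \<open>x\<close> vanishes by hypothesis.\<close>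

lemma is_lie_symmetry_sym_vf:
  assumes \<gamma>: "smooth \<gamma>"
    and \<rho>1: "\<And>t. (\<rho>1 has_real_derivative - \<gamma> t) (at t)"
    and \<rho>2: "\<And>t. (\<rho>2 has_real_derivative - (t * \<gamma> t)) (at t)"
    and p: "degree p \<le> 2" "\<And>t. 3/2 * poly (pderiv p) t * \<gamma> t + poly p t * deriv \<gamma> t = 0"
    and \<eta>0: "is_solution \<gamma> \<eta>0"
  shows "is_lie_symmetry \<gamma> (sym_vf \<rho>1 \<rho>2 p a b m r \<eta>0)"
proof -
  let ?p1 = "pderiv p" and ?p2 = "pderiv (pderiv p)"
  let ?F = "sym_factor \<rho>1 \<rho>2 p a b m r"
  \<comment> \<open>The third derivative of a polynomial of degree at most two is zero, so
    \<open>dt ?F\<close> has no term in the square of \<open>x\<close>.\<close>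
  have "degree (pderiv ?p2) = 0 \<and> coeff (pderiv ?p2) 0 = 0"
    using p(1) by (simp add: degree_pderiv coeff_pderiv coeff_eq_0)
  then have p3: "pderiv ?p2 = 0" by (metis leading_coeff_0_iff)
  have d: "deriv (poly q) = poly (pderiv q)" for q :: "real poly"
    using DERIV_imp_deriv[OF poly_DERIV] by blast
  have ds: "deriv (\<lambda>t. a + b * t) = (\<lambda>t. b)"
    by (intro ext DERIV_imp_deriv) (auto intro!: derivative_eq_intros)
  have Ft: "dt ?F = (\<lambda>t x. \<i> * of_real 0 + of_real (a * - \<gamma> t + b * - (t * \<gamma> t) - poly ?p2 t / 4))"
    unfolding sym_factor_def
    by (rule dt_eqI, rule has_vector_derivative_Complex_parts)
      (auto intro!: derivative_eq_intros poly_DERIV \<rho>1 \<rho>2 simp: p3)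
  have Fx: "dx ?F = (\<lambda>t x. \<i> * of_real (poly ?p2 t * x / 4 + b / 2) + of_real 0)"
    unfolding sym_factor_def
    by (rule dx_eqI, rule has_vector_derivative_Complex_parts) (auto intro!: derivative_eq_intros)
  have Fxx: "dx (dx ?F) = (\<lambda>t x. \<i> * of_real (poly ?p2 t / 4) + of_real 0)"
    unfolding Fx
    by (rule dx_eqI, rule has_vector_derivative_Complex_parts) (auto intro!: derivative_eq_intros)
  have t: "smooth (\<lambda>p::real \<times> real. h (fst p))" if "smooth h" for h :: "real \<Rightarrow> real"
    by (rule smooth_compose[OF that]) (intro smooth_intros)
  have "smooth \<rho>1" "smooth \<rho>2"
    by (rule smooth_real_antiderivative[OF \<rho>1] smooth_real_antiderivative[OF \<rho>2]; intro smooth_intros \<gamma>)+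
  then have "smooth2 ?F" unfolding sym_factor_def
    by (intro smooth_intros t smooth_poly)
  moreover have "smooth2 \<eta>0" "\<And>t x. eqop \<gamma> \<eta>0 t x = 0"
    using \<eta>0 by (auto simp: is_solution_def case_prod_beta')
  moreover have "smooth (\<lambda>t. a + b * t)" by (intro smooth_intros)
  moreover have "factor_condition \<gamma> (poly p) (\<lambda>t. a + b * t) ?F t x = 0" for t x
    unfolding factor_condition_def d Ft Fxx p(2) by (simp add: algebra_simps)
  moreover have "slope_condition (poly p) (\<lambda>t. a + b * t) ?F t x = 0" for t x
    unfolding slope_condition_def d ds Fx by (simp add: algebra_simps)
  ultimately show ?thesis
    unfolding sym_vf_def using is_lie_symmetry_affine_iff[OF smooth_poly, of "\<lambda>t. a + b * t" \<eta>0 ?F \<gamma> p]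
    by (simp add: d)
qed

text \<open>The slope condition integrates to \<eta>1 up to its value \<theta> at
  \<open>x = 0\<close>. The factor condition is then polynomial in \<open>x\<close>, and its
  coefficients are ordinary differential equations that give \<tau>, the shift \<sigma> and
  \<theta>.\<close>

lemma is_lie_symmetry_imp_sym_vf:
  assumes \<rho>1: "\<And>t. (\<rho>1 has_real_derivative - \<gamma> t) (at t)"
    and \<rho>2: "\<And>t. (\<rho>2 has_real_derivative - (t * \<gamma> t)) (at t)"
    and Q: "is_lie_symmetry \<gamma> Q"
  obtains p a b m r \<eta>0 where "Q = sym_vf \<rho>1 \<rho>2 p a b m r \<eta>0" "degree p \<le> 2"
    "\<And>t. 3/2 * poly (pderiv p) t * \<gamma> t + poly p t * deriv \<gamma> t = 0" "is_solution \<gamma> \<eta>0"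
proof -
  obtain \<tau>' \<xi> \<eta> where Q': "Q = (\<tau>', \<xi>, \<eta>)" by (cases Q)
  define T where "T = (\<lambda>t x z. complex_of_real (\<tau>' t x z))"
  define X where "X = (\<lambda>t x z. complex_of_real (\<xi> t x z))"
  have s: "smooth3 \<tau>'" "smooth3 \<xi>" "smooth3 \<eta>" and sym: "\<And>f t x. smooth2 f \<Longrightarrow> eqop \<gamma> f t x = 0 \<Longrightarrow>
      defect \<gamma> (along T f) (along X f) (along \<eta> f) f t x = 0"
    using Q unfolding Q' is_lie_symmetry_iff_defect T_def X_def by blast+
  have sTX: "smooth3 T" "smooth3 X" unfolding T_def X_def using s by (auto intro: smooth_of_real)
  note str = symmetry_structure[OF sTX s(3) sym]
  define \<tau> where "\<tau> t = \<tau>' t 0 0" for t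
  define \<sigma> where "\<sigma> t = \<xi> t 0 0" for t
  define \<eta>0 where "\<eta>0 t x = \<eta> t x 0" for t x
  define \<eta>1 where "\<eta>1 t x = Dp \<eta> t x 0" for t x
  have sm: "smooth \<tau>" "smooth \<sigma>"
    using smooth_compose[OF s(1), of "\<lambda>t. (t, 0, 0)"] smooth_compose[OF s(2), of "\<lambda>t. (t, 0, 0)"]
    by (simp_all add: smooth_intros \<tau>_def[abs_def] \<sigma>_def[abs_def])
  have sm2: "smooth2 \<eta>0" "smooth2 \<eta>1"
    using smooth2_along[OF s(3), of "\<lambda>t x. 0"] smooth2_along[OF smooth3_D3(3)[OF s(3)], of "\<lambda>t x. 0"]
    by (simp_all add: smooth_intros along_def \<eta>0_def \<eta>1_def)
  note \<tau>1 = smooth_deriv[OF sm(1)] and \<sigma>1 = smooth_deriv[OF sm(2)]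
  note \<tau>2 = smooth_deriv[OF \<tau>1(2)] and \<sigma>2 = smooth_deriv[OF \<sigma>1(2)]
  note \<tau>3 = smooth_deriv[OF \<tau>2(2)]
  have "Dt T t 0 0 = of_real (deriv \<tau> t)" for t
  proof -
    have "((\<lambda>s. T s 0 0) has_vector_derivative Dt T t 0 0) (at t)"
      by (rule has_vector_derivative_eq_rhs[OF smooth3_chain[OF sTX(1) has_vector_derivative_id
              has_vector_derivative_const has_vector_derivative_const]]) simp
    moreover have "((\<lambda>s. T s 0 0) has_vector_derivative of_real (deriv \<tau> t)) (at t)"
      using \<tau>1(1)[of t] unfolding T_def \<tau>_def[symmetric]
      by (intro bounded_linear.has_vector_derivative[OF bounded_linear_of_real])
        (simp add: has_real_derivative_iff_has_vector_derivative)
    ultimately show ?thesis using vector_derivative_unique_at by blast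
  qed
  then have "X t x z = of_real (\<sigma> t + deriv \<tau> t * x / 2)" for t x z
    using str(2)[of t x z] by (simp add: X_def \<sigma>_def)
  then have form: "\<tau>' = (\<lambda>t x z. \<tau> t)" "\<xi> = (\<lambda>t x z. \<sigma> t + deriv \<tau> t * x / 2)"
    "\<eta> = (\<lambda>t x z. \<eta>0 t x + \<eta>1 t x * z)"
    using str(1) str(3)[folded \<eta>0_def \<eta>1_def] unfolding T_def X_def \<tau>_def fun_eq_iff of_real_eq_iff by blast+
  have "\<forall>t x. eqop \<gamma> \<eta>0 t x = 0 \<and> factor_condition \<gamma> \<tau> \<sigma> \<eta>1 t x = 0 \<and> slope_condition \<tau> \<sigma> \<eta>1 t x = 0"
    using Q unfolding Q' form is_lie_symmetry_affine_iff[OF sm sm2] .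
  then have sol: "is_solution \<gamma> \<eta>0" and fac: "\<And>t x. factor_condition \<gamma> \<tau> \<sigma> \<eta>1 t x = 0"
    and "\<And>t x. slope_condition \<tau> \<sigma> \<eta>1 t x = 0"
    using sm2 by (auto simp: is_solution_def case_prod_beta')
  then have \<eta>1x: "dx \<eta>1 = (\<lambda>t x. \<i> * of_real (deriv \<sigma> t / 2 + deriv (deriv \<tau>) t * x / 4) + of_real 0)"
    unfolding slope_condition_def fun_eq_iff by (simp add: field_simps)
  define \<theta> where "\<theta> t = \<eta>1 t 0" for t
  have \<eta>1: "\<eta>1 t x = \<theta> t + (\<i> * of_real (deriv \<sigma> t * x / 2 + deriv (deriv \<tau>) t * x\<^sup>2 / 8) + of_real 0)" for t x
  proof -
    have "((\<lambda>x. \<eta>1 t x - (\<i> * of_real (deriv \<sigma> t * x / 2 + deriv (deriv \<tau>) t * x\<^sup>2 / 8) + of_real 0))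
      has_vector_derivative dx \<eta>1 t y
        - (\<i> * of_real (deriv \<sigma> t / 2 + deriv (deriv \<tau>) t * y / 4) + of_real 0)) (at y)" for y
      by (intro has_vector_derivative_diff smooth2_dx sm2 has_vector_derivative_Complex_parts)
        (auto intro!: derivative_eq_intros)
    then have "((\<lambda>x. \<eta>1 t x - (\<i> * of_real (deriv \<sigma> t * x / 2 + deriv (deriv \<tau>) t * x\<^sup>2 / 8) + of_real 0))
      has_vector_derivative 0) (at y)" for y
      unfolding \<eta>1x by simp
    from has_vector_derivative_const_imp_affine[OF this, of x] show ?thesis
      by (simp add: \<theta>_def algebra_simps)
  qed
  define \<theta>' where "\<theta>' t = dt \<eta>1 t 0" for t
  have \<theta>: "(\<theta> has_vector_derivative \<theta>' t) (at t)" for t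
    using smooth2_dt(1)[OF sm2(2), of 0 t] by (simp add: \<theta>_def[abs_def] \<theta>'_def)
  have \<eta>1t: "dt \<eta>1 = (\<lambda>t x. \<theta>' t
      + (\<i> * of_real (deriv (deriv \<sigma>) t * x / 2 + deriv (deriv (deriv \<tau>)) t * x\<^sup>2 / 8) + of_real 0))"
    unfolding \<eta>1
    by (rule dt_eqI, intro has_vector_derivative_add \<theta> has_vector_derivative_Complex_parts)
      (auto intro!: derivative_eq_intros \<sigma>2 \<tau>3)
  have \<eta>1xx: "dx (dx \<eta>1) = (\<lambda>t x. \<i> * of_real (deriv (deriv \<tau>) t / 4) + of_real 0)"
    unfolding \<eta>1x
    by (rule dx_eqI, rule has_vector_derivative_Complex_parts) (auto intro!: derivative_eq_intros)
  define K where "K t = 3/2 * deriv \<tau> t * \<gamma> t + \<tau> t * deriv \<gamma> t" for t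
  have split: "Re (\<theta>' t) = - deriv (deriv \<tau>) t / 4 - (K t * x + \<sigma> t * \<gamma> t)"
    "Im (\<theta>' t) = - (deriv (deriv \<sigma>) t * x / 2 + deriv (deriv (deriv \<tau>)) t * x\<^sup>2 / 8)" for t x
    using fac[of t x] unfolding factor_condition_def \<eta>1t \<eta>1xx K_def[symmetric] complex_eq_iff by auto
  \<comment> \<open>The left sides in \<open>split\<close> do not depend on \<open>x\<close>;
    comparing \<open>x = 0, 1, -1\<close> isolates the coefficients of both powers of
    \<open>x\<close>.\<close>
  have K: "K t = 0" and \<sigma>2_0: "deriv (deriv \<sigma>) t = 0" and \<tau>3_0: "deriv (deriv (deriv \<tau>)) t = 0" for t
    using split[of t 0] split[of t 1] split[of t "-1"] by auto
  define k where "k = deriv (deriv \<tau>) 0"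
  have \<tau>2_const: "deriv (deriv \<tau>) t = k" for t
    using has_vector_derivative_const_imp_affine[of "deriv (deriv \<tau>)" 0 t] \<tau>3(1)
    by (simp add: \<tau>3_0 k_def flip: has_real_derivative_iff_has_vector_derivative)
  \<comment> \<open>The Taylor polynomial of \<tau> at 0, exact because the third derivative of
    \<tau> vanishes.\<close>
  define p where "p = [:\<tau> 0, deriv \<tau> 0, k / 2:]"
  have p1: "poly (pderiv p) t = deriv \<tau> t" for t
    using has_vector_derivative_const_imp_affine[of "deriv \<tau>" k t] \<tau>2(1)
    by (simp add: p_def pderiv_pCons \<tau>2_const flip: has_real_derivative_iff_has_vector_derivative)
  have p0: "poly p t = \<tau> t" for t
  proof -
    have "((\<lambda>s. \<tau> s - poly p s) has_real_derivative 0) (at s)" for s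
      using DERIV_diff[OF \<tau>1(1)[of s] poly_DERIV[of p s]] by (simp add: p1)
    then show ?thesis
      using has_vector_derivative_const_imp_affine[of "\<lambda>s. \<tau> s - poly p s" 0 t]
      by (simp add: p_def flip: has_real_derivative_iff_has_vector_derivative)
  qed
  have p2: "poly (pderiv (pderiv p)) t = k" for t by (simp add: p_def pderiv_pCons)
  define a where "a = \<sigma> 0"
  define b where "b = deriv \<sigma> 0"
  have \<sigma>1_const: "deriv \<sigma> t = b" for t
    using has_vector_derivative_const_imp_affine[of "deriv \<sigma>" 0 t] \<sigma>2(1)
    by (simp add: \<sigma>2_0 b_def flip: has_real_derivative_iff_has_vector_derivative)
  have \<sigma>: "\<sigma> t = a + b * t" for t
    using has_vector_derivative_const_imp_affine[of \<sigma> b t] \<sigma>1(1)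
    by (simp add: \<sigma>1_const a_def mult.commute flip: has_real_derivative_iff_has_vector_derivative)
  \<comment> \<open>The deviation of \<theta> from the part dictated by \<tau> and \<sigma>. It
    turns out constant, and its real and imaginary parts become the weights of I and M.\<close>
  define w where "w t = \<theta> t - of_real (a * \<rho>1 t + b * \<rho>2 t - deriv \<tau> t / 4)" for t
  have "(w has_vector_derivative \<theta>' t - of_real (a * - \<gamma> t + b * - (t * \<gamma> t) - k / 4)) (at t)" for t
    unfolding w_def
    by (intro has_vector_derivative_diff \<theta> bounded_linear.has_vector_derivative[OF bounded_linear_of_real])
      (auto simp: \<tau>2_const simp flip: has_real_derivative_iff_has_vector_derivative
        intro!: derivative_eq_intros \<rho>1 \<rho>2 \<tau>2(1))
  moreover have "\<theta>' t = of_real (a * - \<gamma> t + b * - (t * \<gamma> t) - k / 4)" for t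
    using split[of t 0] by (simp add: complex_eq_iff \<sigma> \<tau>2_const K algebra_simps)
  ultimately have "(w has_vector_derivative 0) (at t)" for t by simp
  then have w: "w t = w 0" for t using has_vector_derivative_const_imp_affine[of w 0 t] by simp
  have "\<theta> t = of_real (a * \<rho>1 t + b * \<rho>2 t - deriv \<tau> t / 4) + w 0" for t
    using w[of t] by (simp add: w_def algebra_simps)
  then have \<eta>1': "\<eta>1 t x = sym_factor \<rho>1 \<rho>2 p a b (Im (w 0)) (Re (w 0)) t x" for t x
    unfolding sym_factor_def \<eta>1 p1 p2 \<sigma>1_const \<tau>2_const by (simp add: complex_eq_iff)
  have "Q = sym_vf \<rho>1 \<rho>2 p a b (Im (w 0)) (Re (w 0)) \<eta>0"
    unfolding Q' form sym_vf_def p0 p1 \<sigma> \<eta>1' ..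
  moreover have "degree p \<le> 2" by (simp add: p_def)
  ultimately show ?thesis
    using that K sol by (simp add: K_def p0 p1)
qed

section \<open>The condition on \<tau> as a linear differential equation\<close>

lemma continuous_zero_off_finite:
  fixes h :: "real \<Rightarrow> real"
  assumes "continuous_on UNIV h" "finite F" "\<And>t. t \<notin> F \<Longrightarrow> h t = 0"
  shows "h t = 0"
proof -
  have "h \<midarrow>t\<rightarrow> h t"
    using assms(1) by (simp add: continuous_on_eq_continuous_at isCont_def)
  moreover have "eventually (\<lambda>s. s \<notin> F) (at t)"
  proof -
    have "eventually (\<lambda>s. s \<in> - (F - {t})) (at t)"
      using assms(2) by (intro eventually_at_in_open' open_Compl finite_imp_closed) auto
    then show ?thesis using eventually_neq_at_within[of t] by eventually_elim auto
  qed
  then have "eventually (\<lambda>s. h s = 0) (at t)" by (rule eventually_mono) (rule assms(3))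
  then have "h \<midarrow>t\<rightarrow> 0" by (rule tendsto_eventually)
  ultimately show ?thesis by (rule tendsto_unique[OF at_neq_bot])
qed

text \<open>Near a non-root the sign of \<open>p\<close> is constant, so the absolute value
  differentiates like a multiple of \<open>p\<close>. Splitting off the power 1/2 leaves the linear
  expression times a nonvanishing factor.\<close>

lemma weighted_power_DERIV:
  assumes "smooth \<gamma>" "poly p t \<noteq> 0"
  shows "((\<lambda>s. \<gamma> s * \<bar>poly p s\<bar> powr (3/2)) has_real_derivative
    (3/2 * poly (pderiv p) t * \<gamma> t + poly p t * deriv \<gamma> t) * (sgn (poly p t) * \<bar>poly p t\<bar> powr (1/2))) (at t)"
proof -
  have abs: "((\<lambda>s. \<bar>poly p s\<bar>) has_real_derivative sgn (poly p t) * poly (pderiv p) t) (at t)"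
  proof (rule has_field_derivative_transform_within_open)
    show "((\<lambda>s. sgn (poly p t) * poly p s) has_real_derivative sgn (poly p t) * poly (pderiv p) t) (at t)"
      by (intro DERIV_cmult poly_DERIV)
    show "open {s. 0 < sgn (poly p t) * poly p s}"
      by (intro open_Collect_less continuous_intros)
  qed (use assms(2) in \<open>auto simp: sgn_if split: if_splits\<close>)
  have "\<bar>poly p t\<bar> powr (3/2) = \<bar>poly p t\<bar> powr (1/2 + 1)" by simp
  also have "\<dots> = sgn (poly p t) * poly p t * \<bar>poly p t\<bar> powr (1/2)"
    unfolding powr_add using assms(2) by (simp add: sgn_if abs_if)
  finally have pw: "\<bar>poly p t\<bar> powr (3/2) = sgn (poly p t) * poly p t * \<bar>poly p t\<bar> powr (1/2)" .
  show ?thesis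
    by (rule DERIV_cong[OF DERIV_mult[OF smooth_deriv(1)[OF assms(1)] DERIV_fun_powr[OF abs, of "3/2"]]])
      (use assms(2) in \<open>simp_all add: pw algebra_simps\<close>)
qed

text \<open>The right side is linear in \<open>p\<close> and is the form delivered by the
  determining equations. From left to right it holds off the roots of \<open>p\<close> and extends
  to them by continuity; finiteness of the root set is why \<open>p = 0\<close> is treated
  apart.\<close>

lemma admissible_tau_iff:
  assumes \<gamma>: "smooth \<gamma>"
  shows "admissible_tau \<gamma> p \<longleftrightarrow>
    degree p \<le> 2 \<and> (\<forall>t. 3/2 * poly (pderiv p) t * \<gamma> t + poly p t * deriv \<gamma> t = 0)"
proof (cases "p = 0")
  case False
  then have fin: "finite {t. poly p t = 0}" by (rule poly_roots_finite)
  let ?E = "\<lambda>t. 3/2 * poly (pderiv p) t * \<gamma> t + poly p t * deriv \<gamma> t"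
  let ?W = "\<lambda>s. \<gamma> s * \<bar>poly p s\<bar> powr (3/2)"
  have "(\<forall>t. (?W has_real_derivative 0) (at t)) \<longleftrightarrow> (\<forall>t. ?E t = 0)"
  proof
    assume W: "\<forall>t. (?W has_real_derivative 0) (at t)"
    have "smooth ?E" by (intro smooth_intros smooth_poly \<gamma> smooth_deriv)
    moreover have "?E t = 0" if "poly p t \<noteq> 0" for t
      using DERIV_unique[OF weighted_power_DERIV[OF \<gamma> that] W[rule_format]] that by (simp add: sgn_eq_0_iff)
    ultimately show "\<forall>t. ?E t = 0"
      using continuous_zero_off_finite[OF smooth_imp_continuous fin, of ?E] by blast
  next
    assume E: "\<forall>t. ?E t = 0"
    show "\<forall>t. (?W has_real_derivative 0) (at t)"
    proof (cases "\<exists>t. poly p t = 0")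
      case True
      txt \<open>The first integral \<open>\<gamma>\<^sup>2 p\<^sup>3\<close> vanishes at the root, which forces \<open>\<gamma> = 0\<close>.\<close>
      then obtain z where z: "poly p z = 0" by blast
      have "((\<lambda>s. (\<gamma> s)\<^sup>2 * poly p s ^ 3) has_real_derivative 2 * \<gamma> t * (poly p t)\<^sup>2 * ?E t) (at t)" for t
        by (auto intro!: derivative_eq_intros smooth_deriv(1)[OF \<gamma>] poly_DERIV
            simp: algebra_simps power2_eq_square power3_eq_cube)
      then have "\<forall>t. ((\<lambda>s. (\<gamma> s)\<^sup>2 * poly p s ^ 3) has_real_derivative 0) (at t)"
        unfolding E[rule_format] by simp
      from DERIV_isconst_all[OF this, of _ z] z have "(\<gamma> t)\<^sup>2 * poly p t ^ 3 = 0" for t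
        by simp
      \<comment> \<open>Off the roots of \<open>p\<close> the vanishing product forces \<gamma> to
        be zero; continuity covers the roots.\<close>
      then have "\<gamma> t = 0" for t
        using continuous_zero_off_finite[OF smooth_imp_continuous[OF \<gamma>] fin] by force
      then show ?thesis by simp
    next
      case False
      then show ?thesis using weighted_power_DERIV[OF \<gamma>, of p] E by simp
    qed
  qed
  then show ?thesis unfolding admissible_tau_def by blast
qed (simp add: admissible_tau_def)

section \<open>The span of the generators\<close>

lemma is_solution_add_scale:
  assumes "is_solution \<gamma> f" "is_solution \<gamma> g"
  shows "is_solution \<gamma> (\<lambda>t x. f t x + of_real c * g t x)"
proof -
  have s[simp]: "smooth2 f" "smooth2 g" and e: "\<And>t x. eqop \<gamma> f t x = 0" "\<And>t x. eqop \<gamma> g t x = 0"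
    using assms by (auto simp: is_solution_def case_prod_beta')
  have "eqop \<gamma> (\<lambda>t x. f t x + of_real c * g t x) t x = eqop \<gamma> f t x + of_real c * eqop \<gamma> g t x" for t x
    unfolding eqop_def by (simp add: dt_simps dx_simps smooth2_simps dt_dx_const algebra_simps)
  then show ?thesis unfolding is_solution_def case_prod_beta' by (simp add: e smooth_intros)
qed

lemma is_solution_zero: "is_solution \<gamma> (\<lambda>t x. 0)"
  by (simp add: is_solution_def eqop_def dt_dx_const smooth_const case_prod_beta')

lemma sym_vf_add_scale:
  "vf_add (sym_vf \<rho>1 \<rho>2 p a b m r \<eta>) (vf_scale c (sym_vf \<rho>1 \<rho>2 p' a' b' m' r' \<eta>'))
    = sym_vf \<rho>1 \<rho>2 (p + smult c p') (a + c * a') (b + c * b') (m + c * m') (r + c * r')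
        (\<lambda>t x. \<eta> t x + of_real c * \<eta>' t x)"
  by (simp add: sym_vf_def sym_factor_def vf_add_def vf_scale_def pderiv_add pderiv_smult fun_eq_iff field_simps)

lemma sym_vf_zero: "vf_zero = sym_vf \<rho>1 \<rho>2 0 0 0 0 0 (\<lambda>t x. 0)"
  by (simp add: vf_zero_def sym_vf_def sym_factor_def)

lemma generators_sym_vf:
  "vfD p = sym_vf \<rho>1 \<rho>2 p 0 0 0 0 (\<lambda>t x. 0)"
  "vf_add (vfG (\<lambda>t. 1)) (vfrhoI \<rho>1) = sym_vf \<rho>1 \<rho>2 0 1 0 0 0 (\<lambda>t x. 0)"
  "vf_add (vfG (\<lambda>t. t)) (vfrhoI \<rho>2) = sym_vf \<rho>1 \<rho>2 0 0 1 0 0 (\<lambda>t x. 0)"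
  "vfM = sym_vf \<rho>1 \<rho>2 0 0 0 1 0 (\<lambda>t x. 0)"
  "vfI = sym_vf \<rho>1 \<rho>2 0 0 0 0 1 (\<lambda>t x. 0)"
  "vfZ \<eta> = sym_vf \<rho>1 \<rho>2 0 0 0 0 0 \<eta>"
  by (simp_all add: vfD_def vfG_def vfrhoI_def vfM_def vfI_def vfZ_def vf_add_def sym_vf_def sym_factor_def
      fun_eq_iff algebra_simps)

text \<open>All parameters of \<open>sym_vf\<close> enter linearly, so normal forms are closed under
  the inductive step of the span. Conversely, each normal form is a sum of at most one generator of
  each kind.\<close>

lemma vf_span_generators:
  assumes \<gamma>: "smooth \<gamma>"
  shows "vf_span (generators \<gamma> \<rho>1 \<rho>2) = {sym_vf \<rho>1 \<rho>2 p a b m r \<eta> | p a b m r \<eta>.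
    admissible_tau \<gamma> p \<and> is_solution \<gamma> \<eta>}" (is "?L = ?R")
proof
  have adm0: "admissible_tau \<gamma> 0" by (simp add: admissible_tau_def)
  have gen: "\<exists>p a b m r \<eta>. Q = sym_vf \<rho>1 \<rho>2 p a b m r \<eta> \<and> admissible_tau \<gamma> p \<and> is_solution \<gamma> \<eta>"
    if "Q \<in> generators \<gamma> \<rho>1 \<rho>2" for Q
    using that adm0 is_solution_zero[of \<gamma>] unfolding generators_def generators_sym_vf[where ?\<rho>1.0 = \<rho>1 and ?\<rho>2.0 = \<rho>2] by blast
  show "?L \<subseteq> ?R"
  proof
    fix Q assume "Q \<in> ?L"
    then show "Q \<in> ?R"
    proof induction
      case zero
      show ?case using sym_vf_zero adm0 is_solution_zero[of \<gamma>] by blast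
    next
      case (step P Q c)
      obtain p a b m r \<eta> where P: "P = sym_vf \<rho>1 \<rho>2 p a b m r \<eta>" "admissible_tau \<gamma> p" "is_solution \<gamma> \<eta>"
        using step.IH by blast
      obtain p' a' b' m' r' \<eta>' where Q: "Q = sym_vf \<rho>1 \<rho>2 p' a' b' m' r' \<eta>'" "admissible_tau \<gamma> p'" "is_solution \<gamma> \<eta>'"
        using gen[OF step.hyps(2)] by blast
      \<comment> \<open>Closure under sums is not apparent from the fractional power in the
        definition; the equation of \<open>admissible_tau_iff\<close> makes it immediate.\<close>
      have "admissible_tau \<gamma> (p + smult c p')"
      proof -
        have "3/2 * poly (pderiv (p + smult c p')) t * \<gamma> t + poly (p + smult c p') t * deriv \<gamma> t
          = (3/2 * poly (pderiv p) t * \<gamma> t + poly p t * deriv \<gamma> t)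
            + c * (3/2 * poly (pderiv p') t * \<gamma> t + poly p' t * deriv \<gamma> t)" for t
          by (simp add: pderiv_add pderiv_smult algebra_simps)
        then show ?thesis using P(2) Q(2) unfolding admissible_tau_iff[OF \<gamma>]
          by (simp add: degree_add_le)
      qed
      then show ?case
        unfolding P(1) Q(1) sym_vf_add_scale using is_solution_add_scale[OF P(3) Q(3), of c] by blast
    qed
  qed
  show "?R \<subseteq> ?L"
  proof
    fix Q assume "Q \<in> ?R"
    then obtain p a b m r \<eta> where Q: "Q = sym_vf \<rho>1 \<rho>2 p a b m r \<eta>"
      and "admissible_tau \<gamma> p" "is_solution \<gamma> \<eta>" by blast
    note step = vf_span.step[where S = "generators \<gamma> \<rho>1 \<rho>2"]
    have G: "sym_vf \<rho>1 \<rho>2 p 0 0 0 0 (\<lambda>t x. 0) \<in> generators \<gamma> \<rho>1 \<rho>2"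
      "sym_vf \<rho>1 \<rho>2 0 1 0 0 0 (\<lambda>t x. 0) \<in> generators \<gamma> \<rho>1 \<rho>2"
      "sym_vf \<rho>1 \<rho>2 0 0 1 0 0 (\<lambda>t x. 0) \<in> generators \<gamma> \<rho>1 \<rho>2"
      "sym_vf \<rho>1 \<rho>2 0 0 0 1 0 (\<lambda>t x. 0) \<in> generators \<gamma> \<rho>1 \<rho>2"
      "sym_vf \<rho>1 \<rho>2 0 0 0 0 1 (\<lambda>t x. 0) \<in> generators \<gamma> \<rho>1 \<rho>2"
      "sym_vf \<rho>1 \<rho>2 0 0 0 0 0 \<eta> \<in> generators \<gamma> \<rho>1 \<rho>2"
      unfolding generators_def generators_sym_vf[where ?\<rho>1.0 = \<rho>1 and ?\<rho>2.0 = \<rho>2]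
      using \<open>admissible_tau \<gamma> p\<close> \<open>is_solution \<gamma> \<eta>\<close> by blast+
    \<comment> \<open>Six steps starting from the zero field. The first and last have weight 1,
      since \<open>p\<close> and \<eta> already carry their own scale.\<close>
    show "Q \<in> ?L" unfolding Q
      using step[OF step[OF step[OF step[OF step[OF step[OF
            vf_span.zero[of "generators \<gamma> \<rho>1 \<rho>2", unfolded sym_vf_zero[of \<rho>1 \<rho>2]]
            G(1), of 1] G(2), of a] G(3), of b] G(4), of m] G(5), of r] G(6), of 1]
      by (simp add: sym_vf_add_scale)
  qed
qed

theorem theorem7:
  fixes \<gamma> \<rho>1 \<rho>2 :: "real \<Rightarrow> real"
  assumes "smooth \<gamma>"
    and "\<And>t. (\<rho>1 has_real_derivative - \<gamma> t) (at t)"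
    and "\<And>t. (\<rho>2 has_real_derivative - (t * \<gamma> t)) (at t)"
  shows "{Q. is_lie_symmetry \<gamma> Q} = vf_span (generators \<gamma> \<rho>1 \<rho>2)"
proof (intro set_eqI iffI)
  fix Q assume "Q \<in> {Q. is_lie_symmetry \<gamma> Q}"
  then obtain p a b m r \<eta>0 where "Q = sym_vf \<rho>1 \<rho>2 p a b m r \<eta>0" "degree p \<le> 2"
    "\<And>t. 3/2 * poly (pderiv p) t * \<gamma> t + poly p t * deriv \<gamma> t = 0" "is_solution \<gamma> \<eta>0"
    using is_lie_symmetry_imp_sym_vf[OF assms(2,3)] by (metis mem_Collect_eq)
  then show "Q \<in> vf_span (generators \<gamma> \<rho>1 \<rho>2)"
    unfolding vf_span_generators[OF assms(1)] admissible_tau_iff[OF assms(1)] by blast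
next
  fix Q assume "Q \<in> vf_span (generators \<gamma> \<rho>1 \<rho>2)"
  then obtain p a b m r \<eta>0 where Q: "Q = sym_vf \<rho>1 \<rho>2 p a b m r \<eta>0" "degree p \<le> 2"
    "\<And>t. 3/2 * poly (pderiv p) t * \<gamma> t + poly p t * deriv \<gamma> t = 0" "is_solution \<gamma> \<eta>0"
    unfolding vf_span_generators[OF assms(1)] admissible_tau_iff[OF assms(1)] by blast
  then show "Q \<in> {Q. is_lie_symmetry \<gamma> Q}"
    using is_lie_symmetry_sym_vf[OF assms Q(2-4)] by simp
qed

end
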